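(* Let $\mathcal{W}$ be a reflection group of type $A_n$ or $B_n$, acting on $\mathbb{R}^N$ (with $N=n+1$ for type $A_n$ and $N=n$ for type $B_n$), let $\mathcal{C}$ be a fundamental chamber of $\mathcal{W}$, and let $\omega\in(0,\infty)^N$ be any weight vector. For a generic point $x\in\mathcal{C}$ and every integer $k\ge 0$, the number of group elements $g\in\mathcal{W}$ such that the weighted projection $\pi_{\mathcal{C}}(gx;g\omega)$ is $k$-dimensional equals the absolute value of the coefficient of $t^k$ in the characteristic polynomial $\chi_{\mathcal{W}}(t)$ of the reflection arrangement of $\mathcal{W}$.
   Context: Groups: $A_n$ is the group of all permutations of the coordinates of $\mathbb{R}^{n+1}$, with mirrors $\{x_i=x_j\}$, $1\le i<j\le n+1$. $B_n$ is the group of all signed permutations of the coordinates of $\mathbb{R}^n$, with mirrors $\{x_i=x_j\}$, $\{x_i=-x_j\}$ ($1\le i<j\le n$) and $\{x_k=0\}$ ($1\le k\le n$). The reflection arrangement of a finite reflection group $\mathcal{W}$ acting on $\mathbb{R}^N$ is the collection of all mirrors (fixed hyperplanes) of reflections in $\mathcal{W}$. A fundamental chamber of $\mathcal{W}$ is the closure of a connected component (region) of the complement of the union of all these hyperplanes. The canonical choices are $\{x\in\mathbb{R}^{n+1}: x_1\le\dots\le x_{n+1}\}$ for $A_n$ and $\{x\in\mathbb{R}^n: 0\le x_1\le\dots\le x_n\}$ for $B_n$. Characteristic polynomial: for a finite collection $\mathcal{A}$ of linear hyperplanes in $\mathbb{R}^N$, let $L(\mathcal{A})$ be the set of all intersections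 of subcollections of $\mathcal{A}$ (including $\mathbb{R}^N$ as the empty intersection), ordered by reverse inclusion. Define $\mu:L(\mathcal{A})\to\mathbb{Z}$ by $\mu(\mathbb{R}^N)=1$ and $\sum_{z\le y}\mu(z)=0$ for all $y\ne\mathbb{R}^N$. Then $\chi_{\mathcal{A}}(t)=\sum_{y\in L(\mathcal{A})}\mu(y)\,t^{\dim y}$, and $\chi_{\mathcal{W}}(t)$ denotes $\chi_{\mathcal{A}}(t)$ for the reflection arrangement $\mathcal{A}$ of $\mathcal{W}$. Weighted projection: for $y\in\mathbb{R}^N$ and a weight vector $\omega\in(0,\infty)^N$, $\pi_{\mathcal{C}}(y;\omega)=\arg\min_{z\in\mathcal{C}}\sum_{i=1}^N\omega_i(z_i-y_i)^2$. It is called $k$-dimensional if it lies in the relative interior of a $k$-dimensional face of $\mathcal{C}$ (where $\mathcal{C}$ itself is a face). Action on weights: $g\omega$ is obtained by permuting the weights along with the coordinates, ignoring signs: if $g$ is such that $(gx)_i=\pm x_j$ for all $x\in\mathbb{R}^N$, then $(g\omega)_i=\omega_j$. "For a generic point $x\in\mathcal{C}$" means: for all $x\in\mathcal{C}$ outside some set of Lebesgue measure zero (which may depend on $\omega$). *)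

theory Defs
  imports "HOL-Analysis.Analysis" "HOL-Computational_Algebra.Polynomial"
begin

text \<open>
  With \<open>N = CARD('n)\<close> coordinates, \<open>typeA\<close> is the group \<open>A_(N-1)\<close> and \<open>typeB\<close> is the group
  \<open>B_N\<close>. Group elements are represented by their action on \<open>real ^ 'n\<close>. No order on the index
  type is needed, because the chamber is not required to be the canonical one.
\<close>

definition typeA :: "(real ^ 'n \<Rightarrow> real ^ 'n) set" where
  "typeA = {(\<lambda>x. \<chi> i. x $ p i) | p. bij p}"

definition typeB :: "(real ^ 'n \<Rightarrow> real ^ 'n) set" where
  "typeB = {(\<lambda>x. \<chi> i. s i * x $ p i) | s p. bij p \<and> (\<forall>i. s i \<in> {1, -1})}"

lemma finite_typeB: "finite (typeB :: (real ^ 'n \<Rightarrow> real ^ 'n) set)"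
proof (rule finite_subset)
  show "typeB \<subseteq> (\<lambda>(s, p) (x :: real ^ 'n). \<chi> i. s i * x $ p i) `
          ((UNIV \<rightarrow>\<^sub>E {1, -1}) \<times> (UNIV :: ('n \<Rightarrow> 'n) set))"
    unfolding typeB_def by (auto simp: image_iff PiE_def)
  show "finite ((\<lambda>(s, p) (x :: real ^ 'n). \<chi> i. s i * x $ p i) `
          ((UNIV \<rightarrow>\<^sub>E {1, -1}) \<times> (UNIV :: ('n \<Rightarrow> 'n) set)))"
    by (intro finite_imageI finite_cartesian_product finite_PiE) auto
qed

lemma typeA_subset_typeB: "typeA \<subseteq> typeB"
proof
  fix g :: "real ^ 'n \<Rightarrow> real ^ 'n"
  assume "g \<in> typeA"
  then obtain p where "bij p" "g = (\<lambda>x. \<chi> i. x $ p i)" by (auto simp: typeA_def)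
  then show "g \<in> typeB"
    unfolding typeB_def by (intro CollectI exI [of _ "\<lambda>_. 1"] exI [of _ p]) simp
qed

lemma finite_typeA: "finite (typeA :: (real ^ 'n \<Rightarrow> real ^ 'n) set)"
  using finite_subset [OF typeA_subset_typeB finite_typeB] .

definition reflection :: "'a :: euclidean_space \<Rightarrow> 'a \<Rightarrow> 'a" where
  "reflection v x = x - (2 * (v \<bullet> x) / (v \<bullet> v)) *\<^sub>R v"

definition reflection_arrangement :: "('a :: euclidean_space \<Rightarrow> 'a) set \<Rightarrow> 'a set set" where
  "reflection_arrangement W = {{x. g x = x} | g. g \<in> W \<and> (\<exists>v. v \<noteq> 0 \<and> g = reflection v)}"

lemma finite_reflection_arrangement: "finite W \<Longrightarrow> finite (reflection_arrangement W)"
  unfolding reflection_arrangement_def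
  by (rule finite_subset [of _ "(\<lambda>g. {x. g x = x}) ` W"]) auto

definition fundamental_chamber ::
    "('a :: euclidean_space \<Rightarrow> 'a) set \<Rightarrow> 'a set \<Rightarrow> bool" where
  "fundamental_chamber W C \<longleftrightarrow>
     (\<exists>R \<in> components (- \<Union> (reflection_arrangement W)). C = closure R)"

text \<open>The case \<open>S = {}\<close> gives the flat \<open>UNIV\<close>.\<close>

definition flats :: "'a set set \<Rightarrow> 'a set set" where
  "flats A = {\<Inter> S | S. S \<subseteq> A}"

lemma finite_flats: "finite A \<Longrightarrow> finite (flats A)"
  unfolding flats_def by (simp add: setcompr_eq_image)

text \<open>
  The order is reverse inclusion, so the sum ranges over the flats strictly below \<open>y\<close>. The value
  for infinite \<open>A\<close> is a dummy that makes the recursion terminate; lemma \<open>sum_flat_mobius\<close> below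
  is the usual defining property.
\<close>

function flat_mobius :: "'a set set \<Rightarrow> 'a set \<Rightarrow> int" where
  "flat_mobius A y =
     (if infinite A then 0
      else if y = UNIV then 1
      else - (\<Sum>z \<in> {z \<in> flats A. y \<subset> z}. flat_mobius A z))"
  by auto
termination
proof (relation "Wellfounded.measure (\<lambda>(A, y). card {z \<in> flats A. y \<subset> z})", simp)
  fix A :: "'a set set" and y z
  assume "\<not> infinite A" and z: "z \<in> {z \<in> flats A. y \<subset> z}"
  then have "finite (flats A)" by (simp add: finite_flats)
  moreover have "{u \<in> flats A. z \<subset> u} \<subset> {u \<in> flats A. y \<subset> u}" using z by blast
  ultimately show "((A, z), (A, y)) \<in> Wellfounded.measure (\<lambda>(A, y). card {z \<in> flats A. y \<subset> z})"
    by (simp add: psubset_card_mono)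
qed

declare flat_mobius.simps [simp del]

lemma flat_mobius_UNIV: "finite A \<Longrightarrow> flat_mobius A UNIV = 1"
  by (simp add: flat_mobius.simps)

lemma sum_flat_mobius:
  assumes "finite A" "y \<in> flats A" "y \<noteq> UNIV"
  shows "(\<Sum>z \<in> {z \<in> flats A. y \<subseteq> z}. flat_mobius A z) = 0"
proof -
  have "{z \<in> flats A. y \<subseteq> z} = insert y {z \<in> flats A. y \<subset> z}" using assms(2) by auto
  then show ?thesis
    using assms by (simp add: finite_flats flat_mobius.simps [of A y])
qed

definition arrangement_charpoly :: "'a :: euclidean_space set set \<Rightarrow> int poly" where
  "arrangement_charpoly A = (\<Sum>y \<in> flats A. monom (flat_mobius A y) (dim y))"

text \<open>
  The minimizer exists and is unique when \<open>C\<close> is closed, convex and nonempty and all weights are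
  positive.
\<close>

definition weighted_projection ::
    "(real ^ 'n) set \<Rightarrow> real ^ 'n \<Rightarrow> real ^ 'n \<Rightarrow> real ^ 'n" where
  "weighted_projection C w y = arg_min_on (\<lambda>z. \<Sum>i\<in>UNIV. w $ i * (z $ i - y $ i)\<^sup>2) C"

definition in_face_of_dim :: "'a :: euclidean_space set \<Rightarrow> nat \<Rightarrow> 'a \<Rightarrow> bool" where
  "in_face_of_dim C k z \<longleftrightarrow> (\<exists>F. F face_of C \<and> aff_dim F = int k \<and> z \<in> rel_interior F)"

text \<open>For \<open>g\<close> in \<open>typeA\<close> or \<open>typeB\<close> there is exactly one such \<open>j\<close> for every \<open>i\<close>.\<close>

definition act_weights :: "(real ^ 'n \<Rightarrow> real ^ 'n) \<Rightarrow> real ^ 'n \<Rightarrow> real ^ 'n" where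
  "act_weights g w =
     (\<chi> i. w $ (THE j. (\<forall>x. g x $ i = x $ j) \<or> (\<forall>x. g x $ i = - (x $ j))))"

end

theory Submission
  imports Defs
begin

text \<open>
  Since \<open>g\<close> carries the weighted distance for \<open>w\<close> to the one for the permuted weights, projecting
  \<open>g x\<close> onto \<open>C\<close> amounts to projecting \<open>x\<close> onto the chamber \<open>inv g ` C\<close> with the fixed weights
  \<open>w\<close>. The group acts simply transitively on chambers, so the count runs over all chambers of the
  arrangement, and rescaling the coordinates by \<open>sqrt (w $ i)\<close> makes the distance Euclidean at the
  cost of replacing the arrangement by a linear image with the same characteristic polynomial.

  For an arbitrary arrangement and generic \<open>x\<close>, the number of chambers onto which \<open>x\<close> projects
  in dimension \<open>k\<close> obeys deletion and restriction. When a hyperplane \<open>H\<close> cuts a chamber \<open>P\<close>, the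
  half containing the projection of \<open>x\<close> onto \<open>P\<close> keeps it, and the projection onto the other half
  is the projection onto \<open>P \<inter> H\<close>; an uncut chamber is unaffected. The absolute coefficients of the
  characteristic polynomial satisfy the same recursion by Whitney's formula.
\<close>

subsection \<open>Projections onto the chambers of an arrangement\<close>

text \<open>The flat of \<open>V\<close> cut out by the normals in \<open>T\<close>. As
  \<open>T\<close> need not lie in \<open>V\<close>, restricting to a hyperplane changes only
  \<open>V\<close> and keeps the normals.\<close>

definition perp :: "'a::euclidean_space set \<Rightarrow> 'a set \<Rightarrow> 'a set" where
  "perp V T = {z \<in> V. \<forall>v\<in>T. v \<bullet> z = 0}"

text \<open>
  An arrangement inside the subspace \<open>V\<close> is given by a set \<open>A\<close> of normal vectors. A subset \<open>S\<close> of
  \<open>A\<close> encodes a sign vector, positive exactly on \<open>S\<close>; it is realized by a chamber iff its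
  \<open>open_cell\<close> is nonempty. Normals that agree on \<open>V\<close> up to a scalar, or vanish on \<open>V\<close>, are
  allowed, because restricting to a hyperplane produces them.
\<close>

definition cell :: "'a::euclidean_space set \<Rightarrow> 'a set \<Rightarrow> 'a set \<Rightarrow> 'a set" where
  "cell V A S = {y \<in> V. (\<forall>v\<in>S. v \<bullet> y \<ge> 0) \<and> (\<forall>v\<in>A - S. v \<bullet> y \<le> 0)}"

definition open_cell :: "'a::euclidean_space set \<Rightarrow> 'a set \<Rightarrow> 'a set \<Rightarrow> 'a set" where
  "open_cell V A S = {y \<in> V. (\<forall>v\<in>S. v \<bullet> y > 0) \<and> (\<forall>v\<in>A - S. v \<bullet> y < 0)}"

text \<open>Whitney's subset sum for the characteristic polynomial. It obeys deletion and
  restriction for any finite set of normals: one that is on \<open>V\<close> a nonzero multiple of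
  another changes nothing, and one that vanishes on \<open>V\<close> makes the sum zero.\<close>

definition whitney_poly :: "'a::euclidean_space set \<Rightarrow> 'a set \<Rightarrow> int poly" where
  "whitney_poly V A = (\<Sum>T\<in>Pow A. monom ((-1) ^ card T) (dim (perp V T)))"

text \<open>
  The orthogonal projection \<open>y\<close> of \<open>x\<close> to a flat lies on no hyperplane that does not contain the flat.
\<close>

definition generic :: "'a::euclidean_space set \<Rightarrow> 'a set \<Rightarrow> 'a \<Rightarrow> bool" where
  "generic V A x \<longleftrightarrow> (\<forall>T\<subseteq>A. \<forall>v\<in>A. \<forall>y\<in>perp V T.
     (\<forall>z\<in>perp V T. (x - y) \<bullet> z = 0) \<longrightarrow> v \<bullet> y = 0 \<longrightarrow> (\<forall>z\<in>perp V T. v \<bullet> z = 0))"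

text \<open>The dimension of the smallest flat through \<open>y\<close>. On a cell of the whole
  space this is the dimension of the face with \<open>y\<close> in its relative interior, by
  \<open>in_face_of_dim_cell\<close>.\<close>

definition face_dim :: "'a::euclidean_space set \<Rightarrow> 'a set \<Rightarrow> 'a \<Rightarrow> nat" where
  "face_dim V A y = dim (perp V {v \<in> A. v \<bullet> y = 0})"

text \<open>In a subspace \<open>V\<close> every cell contains 0, so nonemptiness of
  \<open>open_cell\<close> is what singles out the sign vectors of chambers.\<close>

definition projects_to_dim ::
    "'a::euclidean_space set \<Rightarrow> 'a set \<Rightarrow> 'a \<Rightarrow> nat \<Rightarrow> 'a set \<Rightarrow> bool" where
  "projects_to_dim V A x k S \<longleftrightarrow>
     open_cell V A S \<noteq> {} \<and> face_dim V A (closest_point (cell V A S) x) = k"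


section \<open>Deletion and restriction for Whitney's sum\<close>

lemma sum_Pow_insert:
  fixes f :: "'a set \<Rightarrow> 'b::comm_monoid_add"
  assumes "finite A" "v \<notin> A"
  shows "sum f (Pow (insert v A)) = (\<Sum>S\<in>Pow A. f S + f (insert v S))"
proof -
  have "inj_on (insert v) (Pow A)"
    using assms(2) by (auto simp: inj_on_def)
  moreover have "Pow A \<inter> insert v ` Pow A = {}"
    using assms(2) by auto
  ultimately show ?thesis
    using assms(1) by (simp add: Pow_insert sum.union_disjoint sum.reindex sum.distrib)
qed

lemma subspace_perp: "subspace V \<Longrightarrow> subspace (perp V T)"
  by (auto simp: perp_def subspace_def inner_right_distrib)

lemma perp_insert: "perp V (insert v T) = perp (perp V {v}) T"
  by (auto simp: perp_def)

text \<open>A subset gaining \<open>v\<close> has one more element, hence the opposite sign, and by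
  \<open>perp_insert\<close> its flat is a flat of the restriction to the hyperplane of
  \<open>v\<close>.\<close>

lemma whitney_poly_insert:
  assumes "finite A" "v \<notin> A"
  shows "whitney_poly V (insert v A) = whitney_poly V A - whitney_poly (perp V {v}) A"
proof -
  have "whitney_poly V (insert v A) = (\<Sum>T\<in>Pow A. monom ((-1) ^ card T) (dim (perp V T))
      - monom ((-1) ^ card T) (dim (perp (perp V {v}) T)))"
    unfolding whitney_poly_def sum_Pow_insert[OF assms]
  proof (rule sum.cong[OF refl])
    fix T assume "T \<in> Pow A"
    then have "card (insert v T) = Suc (card T)"
      using assms by (auto intro!: card_insert_disjoint intro: finite_subset)
    then show "monom ((-1) ^ card T) (dim (perp V T))
         + monom ((-1) ^ card (insert v T)) (dim (perp V (insert v T)))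
       = monom ((-1::int) ^ card T) (dim (perp V T))
         - monom ((-1) ^ card T) (dim (perp (perp V {v}) T))"
      by (simp add: perp_insert[of V v T] minus_monom)
  qed
  then show ?thesis
    by (simp add: whitney_poly_def sum_subtractf)
qed

lemma dim_perp_singleton:
  assumes "subspace V" "w \<in> V" "v \<bullet> w \<noteq> 0"
  shows "dim V = Suc (dim (perp V {v}))"
proof -
  let ?U = "perp V {v}"
  have U: "subspace ?U" by (rule subspace_perp[OF assms(1)])
  have "w \<notin> span ?U"
    using assms(3) U by (subst span_eq_iff[THEN iffD2]) (auto simp: perp_def)
  moreover have "span (insert w ?U) = span V"
  proof
    show "span (insert w ?U) \<subseteq> span V"
      using assms by (intro span_mono) (auto simp: perp_def)
    have "V \<subseteq> span (insert w ?U)"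
    proof
      fix y assume y: "y \<in> V"
      let ?c = "(v \<bullet> y) / (v \<bullet> w)"
      have "y - ?c *\<^sub>R w \<in> ?U"
        using assms y by (auto simp: perp_def subspace_diff subspace_scale inner_diff_right)
      then show "y \<in> span (insert w ?U)"
        by (metis span_breakdown_eq span_base)
    qed
    then show "span V \<subseteq> span (insert w ?U)"
      by (simp add: span_minimal)
  qed
  ultimately show ?thesis
    by (metis dim_insert dim_span add.commute plus_1_eq_Suc)
qed

section \<open>Cells, and how a further hyperplane divides them\<close>

lemma closed_cell: "subspace V \<Longrightarrow> closed (cell V A S)"
proof -
  assume "subspace V"
  then have "closed (V \<inter> ((\<Inter>v\<in>S. {y. v \<bullet> y \<ge> 0}) \<inter> (\<Inter>v\<in>A - S. {y. v \<bullet> y \<le> 0})))"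
    by (intro closed_Int closed_INT ballI closed_subspace closed_halfspace_ge closed_halfspace_le)
  moreover have "cell V A S = V \<inter> ((\<Inter>v\<in>S. {y. v \<bullet> y \<ge> 0}) \<inter> (\<Inter>v\<in>A - S. {y. v \<bullet> y \<le> 0}))"
    by (auto simp: cell_def)
  ultimately show ?thesis by simp
qed

lemma convex_cell: "subspace V \<Longrightarrow> convex (cell V A S)"
  unfolding cell_def convex_def
  by (auto simp: inner_right_distrib subspace_add subspace_scale
      intro!: add_nonpos_nonpos mult_nonneg_nonpos)

lemma open_cell_subset_cell: "open_cell V A S \<subseteq> cell V A S"
  by (force simp: open_cell_def cell_def)

lemma cells_insert:
  assumes "v \<notin> A" "S \<subseteq> A"
  shows "cell V (insert v A) (insert v S) = {y \<in> cell V A S. v \<bullet> y \<ge> 0}"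
    "cell V (insert v A) S = {y \<in> cell V A S. v \<bullet> y \<le> 0}"
    "cell (perp V {v}) A S = {y \<in> cell V A S. v \<bullet> y = 0}"
    "open_cell V (insert v A) (insert v S) = {y \<in> open_cell V A S. v \<bullet> y > 0}"
    "open_cell V (insert v A) S = {y \<in> open_cell V A S. v \<bullet> y < 0}"
    "open_cell (perp V {v}) A S = {y \<in> open_cell V A S. v \<bullet> y = 0}"
  using assms by (auto simp: cell_def open_cell_def perp_def)

text \<open>Finitely many strict inequalities survive a small move in either direction; normals
  vanishing at \<open>y\<close> are left free.\<close>

lemma small_perturbation:
  assumes "finite A"
  shows "\<exists>t>0. \<forall>s. \<bar>s\<bar> \<le> t \<longrightarrow> (\<forall>v\<in>A. (v \<bullet> y > 0 \<longrightarrow> v \<bullet> (y + s *\<^sub>R z) > 0) \<and>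
           (v \<bullet> y < 0 \<longrightarrow> v \<bullet> (y + s *\<^sub>R z) < (0::real)))"
  using assms
proof (induction A)
  case empty
  show ?case by (auto intro: exI[of _ 1])
next
  case (insert v A)
  then obtain t where t: "t > 0" "\<And>s. \<bar>s\<bar> \<le> t \<Longrightarrow> (\<forall>v\<in>A. (v \<bullet> y > 0 \<longrightarrow> v \<bullet> (y + s *\<^sub>R z) > 0) \<and>
           (v \<bullet> y < 0 \<longrightarrow> v \<bullet> (y + s *\<^sub>R z) < 0))"
    by blast
  show ?case
  proof (cases "v \<bullet> y = 0")
    case True
    then show ?thesis using t by (intro exI[of _ t]) auto
  next
    case False
    \<comment> \<open>Adding 1 to the denominator covers \<open>v \<bullet> z = 0\<close> and makes
      the bound below strict.\<close>
    define r where "r = \<bar>v \<bullet> y\<bar> / (1 + \<bar>v \<bullet> z\<bar>)"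
    have r: "r > 0" using False by (simp add: r_def)
    have "\<bar>s * (v \<bullet> z)\<bar> < \<bar>v \<bullet> y\<bar>" if "\<bar>s\<bar> \<le> r" for s
    proof -
      have "\<bar>s\<bar> * \<bar>v \<bullet> z\<bar> \<le> r * \<bar>v \<bullet> z\<bar>" using that by (intro mult_right_mono) auto
      also have "\<dots> < r * (1 + \<bar>v \<bullet> z\<bar>)" using r by simp
      also have "\<dots> = \<bar>v \<bullet> y\<bar>" by (simp add: r_def)
      finally show ?thesis by (simp add: abs_mult)
    qed
    then have "(v \<bullet> y > 0 \<longrightarrow> v \<bullet> (y + s *\<^sub>R z) > 0) \<and> (v \<bullet> y < 0 \<longrightarrow> v \<bullet> (y + s *\<^sub>R z) < 0)"
      if "\<bar>s\<bar> \<le> r" for s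
      using that[THEN \<open>\<And>s. \<bar>s\<bar> \<le> r \<Longrightarrow> _\<close>] by (auto simp: inner_right_distrib)
    then show ?thesis using t r
      by (intro exI[of _ "min t r"]) auto
  qed
qed

text \<open>The case of interest has \<open>y\<close> on the new hyperplane. The cell contains small
  moves of \<open>y\<close> both ways along the flat \<open>perp V ?T\<close>, so \<open>y\<close>
  is the orthogonal projection of \<open>x\<close> to that flat. Genericity then makes
  \<open>v\<close> vanish on the flat, and adding \<open>v\<close> does not shrink it.\<close>

lemma projection_face_dim_insert:
  assumes "finite A" "subspace V" "generic V (insert v A) x" "S \<subseteq> A" "cell V A S \<noteq> {}"
  defines "y \<equiv> closest_point (cell V A S) x"
  shows "face_dim V (insert v A) y = face_dim V A y"
proof (cases "v \<bullet> y = 0")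
  case False
  then have "{u \<in> insert v A. u \<bullet> y = 0} = {u \<in> A. u \<bullet> y = 0}" by auto
  then show ?thesis by (simp add: face_dim_def)
next
  case True
  let ?T = "{u \<in> A. u \<bullet> y = 0}"
  have y: "y \<in> cell V A S"
    unfolding y_def using assms by (intro closest_point_in_set closed_cell)
  then have yT: "y \<in> perp V ?T" by (auto simp: perp_def cell_def)
  have orth: "(x - y) \<bullet> z = 0" if z: "z \<in> perp V ?T" for z
  proof -
    obtain t where t: "t > 0" "\<And>s. \<bar>s\<bar> \<le> t \<Longrightarrow> (\<forall>v\<in>A. (v \<bullet> y > 0 \<longrightarrow> v \<bullet> (y + s *\<^sub>R z) > 0) \<and>
           (v \<bullet> y < 0 \<longrightarrow> v \<bullet> (y + s *\<^sub>R z) < 0))"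
      using small_perturbation[OF assms(1), of y z] by blast
    have in_cell: "y + s *\<^sub>R z \<in> cell V A S" if s: "\<bar>s\<bar> \<le> t" for s
    proof -
      have "y + s *\<^sub>R z \<in> V"
        using y z assms(2) by (auto simp: cell_def perp_def subspace_add subspace_scale)
      moreover have "u \<bullet> (y + s *\<^sub>R z) \<ge> 0" if "u \<in> S" for u
      proof (cases "u \<bullet> y = 0")
        case True
        then show ?thesis using z that assms(4) by (auto simp: perp_def inner_right_distrib)
      next
        case False
        then have "u \<bullet> y > 0" using y that by (force simp: cell_def)
        then show ?thesis using t(2)[OF s] that assms(4) by force
      qed
      moreover have "u \<bullet> (y + s *\<^sub>R z) \<le> 0" if "u \<in> A - S" for u
      proof (cases "u \<bullet> y = 0")
        case True
        then show ?thesis using z that by (auto simp: perp_def inner_right_distrib)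
      next
        case False
        then have "u \<bullet> y < 0" using y that by (force simp: cell_def)
        then show ?thesis using t(2)[OF s] that by force
      qed
      ultimately show ?thesis by (simp add: cell_def)
    qed
    \<comment> \<open>The obtuse angle inequality at \<open>y\<close>; using it for both
      \<open>t\<close> and \<open>-t\<close> gives orthogonality.\<close>
    have "s * ((x - y) \<bullet> z) \<le> 0" if "\<bar>s\<bar> \<le> t" for s
      using closest_point_dot[OF convex_cell closed_cell in_cell[OF that], of x]
        assms(2) by (simp add: y_def)
    from this[of t] this[of "-t"] show ?thesis
      using t(1) by (simp add: mult_le_0_iff zero_le_mult_iff)
  qed
  have "\<forall>z\<in>perp V ?T. v \<bullet> z = 0"
    using assms(3)[unfolded generic_def, rule_format, of ?T v y] yT orth True by auto
  then have "perp V (insert v ?T) = perp V ?T" by (auto simp: perp_def)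
  moreover have "{u \<in> insert v A. u \<bullet> y = 0} = insert v ?T" using True by auto
  ultimately show ?thesis by (simp add: face_dim_def)
qed

section \<open>Closest points in the halves of a chamber\<close>

lemma closest_point_subset_eq:
  assumes "convex P" "closed P" "convex Q" "closed Q" "Q \<subseteq> P" "closest_point P x \<in> Q"
  shows "closest_point Q x = closest_point P x"
  using assms
  by (intro closest_point_unique[symmetric]) (auto intro: closest_point_le)

text \<open>Otherwise the segment from the closest point of \<open>P\<close> to that of
  \<open>Q\<close> meets the hyperplane in a point of \<open>Q\<close> nearer to \<open>x\<close>
  than the latter, by convexity of the distance.\<close>

lemma closest_point_beyond_hyperplane:
  fixes P :: "'a::euclidean_space set"
  assumes P: "convex P" "closed P" and Q: "Q = {y \<in> P. v \<bullet> y \<le> 0}" "Q \<noteq> {}"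
    and pos: "v \<bullet> closest_point P x \<ge> 0"
  shows "v \<bullet> closest_point Q x = 0"
proof (rule ccontr)
  let ?y = "closest_point P x" and ?z = "closest_point Q x"
  assume nz: "v \<bullet> ?z \<noteq> 0"
  have "Q = P \<inter> {y. v \<bullet> y \<le> 0}" using Q by auto
  then have cQ: "convex Q" "closed Q"
    using P by (auto intro: convex_Int closed_Int convex_halfspace_le closed_halfspace_le)
  have z: "?z \<in> Q" using cQ Q by (intro closest_point_in_set)
  have yP: "?y \<in> P" using P Q by (intro closest_point_in_set) auto
  have neg: "v \<bullet> ?z < 0" using nz z Q by auto
  \<comment> \<open>The parameter at which the segment from \<open>?y\<close> to \<open>?z\<close>
    meets the hyperplane; \<open>t < 1\<close> keeps a positive share of the strictly shorter
    distance \<open>dist x ?y\<close>.\<close>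
  define t where "t = (v \<bullet> ?y) / (v \<bullet> ?y - v \<bullet> ?z)"
  have t: "0 \<le> t" "t < 1" using pos neg by (auto simp: t_def field_simps)
  let ?w = "(1 - t) *\<^sub>R ?y + t *\<^sub>R ?z"
  have "v \<bullet> ?w = (v \<bullet> ?y) - t * (v \<bullet> ?y - v \<bullet> ?z)"
    by (simp add: inner_right_distrib inner_diff_right algebra_simps)
  then have "v \<bullet> ?w = 0"
    using pos neg by (simp add: t_def)
  moreover have "?w \<in> P"
    using P(1) yP z Q t by (auto simp: convex_alt)
  ultimately have w: "?w \<in> Q" using Q by auto
  have ne: "?y \<noteq> ?z" using pos neg by auto
  have lt: "dist x ?y < dist x ?z"
  proof -
    have "dist x ?y \<le> dist x ?z"
      using z Q P by (intro closest_point_le) auto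
    moreover have "dist x ?y \<noteq> dist x ?z"
    proof
      assume "dist x ?y = dist x ?z"
      then have "\<forall>u\<in>P. dist x ?z \<le> dist x u"
        using closest_point_le[OF P(2)] by metis
      then show False
        using closest_point_unique[OF P, of ?z x] z Q ne by auto
    qed
    ultimately show ?thesis by simp
  qed
  have "x - ?w = (1 - t) *\<^sub>R (x - ?y) + t *\<^sub>R (x - ?z)"
    by (simp add: algebra_simps)
  then have "dist x ?w \<le> (1 - t) * dist x ?y + t * dist x ?z"
    using t by (metis dist_norm norm_triangle_ineq norm_scaleR abs_of_nonneg diff_ge_0_iff_ge less_imp_le)
  also have "\<dots> < (1 - t) * dist x ?z + t * dist x ?z"
    using lt t by simp
  also have "\<dots> = dist x ?z" by (simp add: algebra_simps)
  finally show False
    using closest_point_le[OF cQ(2) w, of x] by simp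
qed

lemma open_cell_segment:
  assumes V: "subspace V" and a: "a \<in> open_cell V A S" and y: "y \<in> cell V A S"
    and t: "0 < t" "t \<le> (1::real)"
  shows "(1 - t) *\<^sub>R y + t *\<^sub>R a \<in> open_cell V A S"
proof -
  have "(1 - t) *\<^sub>R y + t *\<^sub>R a \<in> V"
    using V a y by (auto simp: open_cell_def cell_def subspace_add subspace_scale)
  moreover have "u \<bullet> ((1 - t) *\<^sub>R y + t *\<^sub>R a) > 0" if "u \<in> S" for u
    using a y t that
    by (auto simp: open_cell_def cell_def inner_right_distrib intro!: add_nonneg_pos mult_nonneg_nonneg)
  moreover have "u \<bullet> ((1 - t) *\<^sub>R y + t *\<^sub>R a) < 0" if "u \<in> A - S" for u
    using a y t that
    by (auto simp: open_cell_def cell_def inner_right_distrib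
        intro!: add_nonpos_neg mult_nonneg_nonpos mult_pos_neg)
  ultimately show ?thesis by (auto simp: open_cell_def)
qed

text \<open>The segment to \<open>a\<close> from a point \<open>y\<close> on the other side would
  meet the hyperplane, and past its starting point it runs inside the open cell.\<close>

lemma cell_one_side:
  assumes V: "subspace V" and a: "a \<in> open_cell V A S" "v \<bullet> a > 0"
    and no: "\<And>z. z \<in> open_cell V A S \<Longrightarrow> v \<bullet> z \<noteq> 0" and y: "y \<in> cell V A S"
  shows "v \<bullet> y \<ge> 0"
proof (rule ccontr)
  assume "\<not> v \<bullet> y \<ge> 0"
  then have neg: "v \<bullet> y < 0" by simp
  define t where "t = - (v \<bullet> y) / (v \<bullet> a - v \<bullet> y)"
  have t: "0 < t" "t \<le> 1" using neg a(2) by (auto simp: t_def field_simps)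
  have "v \<bullet> ((1 - t) *\<^sub>R y + t *\<^sub>R a) = v \<bullet> y + t * (v \<bullet> a - v \<bullet> y)"
    by (simp add: inner_right_distrib algebra_simps)
  also have "\<dots> = 0" using neg a(2) by (simp add: t_def)
  finally show False using no[OF open_cell_segment[OF V a(1) y t]] by simp
qed

lemma face_dim_insert_on_hyperplane:
  "v \<bullet> z = 0 \<Longrightarrow> face_dim V (insert v A) z = face_dim (perp V {v}) A z"
proof -
  assume "v \<bullet> z = 0"
  then have "perp V {u \<in> insert v A. u \<bullet> z = 0} = perp (perp V {v}) {u \<in> A. u \<bullet> z = 0}"
    by (auto simp: perp_def)
  then show ?thesis by (simp add: face_dim_def)
qed

text \<open>Deletion and restriction for a single chamber. If the hyperplane misses it, one open
  half is empty and the other half is the whole chamber; if not, both halves and the restricted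
  chamber occur. Summing over \<open>S\<close> gives the recursion for the counts.\<close>

lemma projects_to_dim_insert:
  assumes A: "finite A" "v \<notin> A" "S \<subseteq> A" and V: "subspace V" and w: "w \<in> V" "v \<bullet> w \<noteq> 0"
    and gen: "generic V (insert v A) x"
  shows "of_bool (projects_to_dim V (insert v A) x k S)
      + of_bool (projects_to_dim V (insert v A) x k (insert v S))
    = (of_bool (projects_to_dim V A x k S) + of_bool (projects_to_dim (perp V {v}) A x k S) :: int)"
proof -
  note cells = cells_insert[OF A(2,3), of V]
  let ?P = "cell V A S" and ?H = "cell (perp V {v}) A S"
  let ?Pp = "cell V (insert v A) (insert v S)" and ?Pn = "cell V (insert v A) S"
  let ?y = "closest_point ?P x"
  have V0: "subspace (perp V {v})" by (rule subspace_perp[OF V])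
  show ?thesis
  proof (cases "open_cell V A S = {}")
    case True
    then show ?thesis by (simp add: projects_to_dim_def cells)
  next
    case False
    then obtain a where a: "a \<in> open_cell V A S" by auto
    then have P: "?P \<noteq> {}" using open_cell_subset_cell by blast
    have dim_y: "face_dim V (insert v A) ?y = face_dim V A ?y"
      by (rule projection_face_dim_insert[OF A(1) V gen A(3) P])
    show ?thesis
    proof (cases "open_cell (perp V {v}) A S = {}")
      case True
      then have no: "v \<bullet> z \<noteq> 0" if "z \<in> open_cell V A S" for z
        using that by (auto simp: cells)
      show ?thesis
      proof (cases "v \<bullet> a > 0")
        case pos: True
        have "v \<bullet> z \<ge> 0" if "z \<in> ?P" for z
          using cell_one_side[OF V a pos no that] by simp
        then have "?Pp = ?P" "open_cell V (insert v A) S = {}"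
          using open_cell_subset_cell[of V A S] by (auto simp: cells) (meson in_mono not_less)
        moreover have "open_cell V (insert v A) (insert v S) \<noteq> {}"
          using a pos by (auto simp: cells)
        ultimately show ?thesis using True False dim_y by (simp add: projects_to_dim_def)
      next
        case npos: False
        then have neg: "(- v) \<bullet> a > 0" using no[OF a] by simp
        have "v \<bullet> z \<le> 0" if "z \<in> ?P" for z
          using cell_one_side[OF V a neg _ that] no by simp
        then have "?Pn = ?P" "open_cell V (insert v A) (insert v S) = {}"
          using open_cell_subset_cell[of V A S] by (auto simp: cells) (meson in_mono not_less)
        moreover have "open_cell V (insert v A) S \<noteq> {}"
          using a neg by (auto simp: cells)
        ultimately show ?thesis using True False dim_y by (simp add: projects_to_dim_def)
      qed
    next
      case crossed: False
      then obtain b where b: "b \<in> open_cell V A S" "v \<bullet> b = 0" by (auto simp: cells)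
      \<comment> \<open>Moving \<open>b\<close> slightly along \<open>w\<close> and
        \<open>-w\<close> reaches both sides of the hyperplane within the open cell.\<close>
      obtain t where t: "t > 0" "\<And>s. \<bar>s\<bar> \<le> t \<Longrightarrow> (\<forall>u\<in>A. (u \<bullet> b > 0 \<longrightarrow> u \<bullet> (b + s *\<^sub>R w) > 0) \<and>
           (u \<bullet> b < 0 \<longrightarrow> u \<bullet> (b + s *\<^sub>R w) < 0))"
        using small_perturbation[OF A(1), of b w] by blast
      have near: "b + s *\<^sub>R w \<in> open_cell V A S" "v \<bullet> (b + s *\<^sub>R w) = s * (v \<bullet> w)" if "\<bar>s\<bar> \<le> t" for s
        using t(2)[OF that] b A(3) V w
        by (auto simp: open_cell_def subspace_add subspace_scale inner_right_distrib)
      have ne: "open_cell V (insert v A) S \<noteq> {}" "open_cell V (insert v A) (insert v S) \<noteq> {}"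
        using near[of t] near[of "-t"] t(1) w(2) unfolding cells
        by (cases "v \<bullet> w > 0"; force simp: mult_less_0_iff zero_less_mult_iff)+
      have P0: "?H \<noteq> {}" and Pne: "?Pp \<noteq> {}" "?Pn \<noteq> {}"
        using crossed ne open_cell_subset_cell by blast+
      note cc = convex_cell[OF V] closed_cell[OF V] convex_cell[OF V0] closed_cell[OF V0]
      have yP: "?y \<in> ?P" using P cc by (intro closest_point_in_set)
      show ?thesis
      proof (cases "v \<bullet> ?y \<ge> 0")
        case True
        let ?z = "closest_point ?Pn x"
        txt \<open>The half containing \<open>?y\<close> inherits the projection; that of the other half is pushed onto
          the hyperplane, where it is the projection to the restricted chamber.\<close>
        have "closest_point ?Pp x = ?y"
          using True yP by (intro closest_point_subset_eq cc) (auto simp: cells)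
        moreover have z: "v \<bullet> ?z = 0"
          by (rule closest_point_beyond_hyperplane[OF _ _ _ Pne(2) True]) (auto simp: cells cc)
        moreover have "?z \<in> ?Pn" using Pne cc by (intro closest_point_in_set)
        then have "closest_point ?H x = ?z"
          using z by (intro closest_point_subset_eq cc) (auto simp: cells)
        ultimately show ?thesis
          using ne crossed False dim_y by (simp add: projects_to_dim_def face_dim_insert_on_hyperplane)
      next
        case neg: False
        let ?z = "closest_point ?Pp x"
        have "closest_point ?Pn x = ?y"
          using neg yP by (intro closest_point_subset_eq cc) (auto simp: cells)
        moreover have "(- v) \<bullet> ?z = 0"
          by (rule closest_point_beyond_hyperplane[OF _ _ _ Pne(1), of ?P])
            (use neg in \<open>auto simp: cells cc\<close>)
        then have z: "v \<bullet> ?z = 0" by simp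
        moreover have "?z \<in> ?Pp" using Pne cc by (intro closest_point_in_set)
        then have "closest_point ?H x = ?z"
          using z by (intro closest_point_subset_eq cc) (auto simp: cells)
        ultimately show ?thesis
          using ne crossed False dim_y by (simp add: projects_to_dim_def face_dim_insert_on_hyperplane)
      qed
    qed
  qed
qed

section \<open>Generic points and the count of chambers\<close>

lemma generic_subset: "generic V B x \<Longrightarrow> A \<subseteq> B \<Longrightarrow> generic V A x"
  unfolding generic_def by (meson subset_iff)

text \<open>A flat of the restriction is a flat of the larger arrangement, with \<open>v\<close>
  among its normals.\<close>

lemma generic_restrict:
  assumes "generic V (insert v A) x"
  shows "generic (perp V {v}) A x"
  unfolding generic_def
proof (intro allI impI ballI)
  fix T u y z
  assume "T \<subseteq> A" "u \<in> A" and y: "y \<in> perp (perp V {v}) T"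
    "\<forall>z\<in>perp (perp V {v}) T. (x - y) \<bullet> z = 0" "u \<bullet> y = 0" "z \<in> perp (perp V {v}) T"
  then show "u \<bullet> z = 0"
    using assms[unfolded generic_def, rule_format, of "insert v T" u y z]
    unfolding perp_insert[of V v T] by auto
qed

text \<open>The exponent \<open>dim V + k\<close> stands for the codimension \<open>dim V - k\<close>, without truncation.\<close>

lemma card_projects_to_dim:
  assumes "finite A" "subspace V" "generic V A x"
  shows "int (card {S \<in> Pow A. projects_to_dim V A x k S}) = (-1) ^ (dim V + k) * coeff (whitney_poly V A) k"
  using assms
proof (induction A arbitrary: V rule: finite_induct)
  case empty
  \<comment> \<open>The only cell is \<open>V\<close> itself and the only exponent is its dimension;
    at \<open>k = dim V\<close> the sign is an even power of \<open>-1\<close>.\<close>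
  have "cell V {} {} = V" "open_cell V {} {} = V" "face_dim V {} y = dim V" for y
    by (auto simp: cell_def open_cell_def face_dim_def perp_def)
  moreover have "V \<noteq> {}" using empty(1) subspace_0 by blast
  moreover have "perp V {} = V" by (auto simp: perp_def)
  moreover have "{S \<in> Pow {}. projects_to_dim V {} x k S}
      = (if projects_to_dim V {} x k {} then {{}} else {})" by auto
  ultimately show ?case
    by (auto simp: projects_to_dim_def whitney_poly_def)
next
  case (insert v A)
  let ?H = "perp V {v}"
  have count: "int (card {S \<in> Pow B. Q S}) = (\<Sum>S\<in>Pow B. of_bool (Q S))" if "finite B"
    for B :: "'a set" and Q
  proof -
    have "{S \<in> Pow B. Q S} = Pow B \<inter> Collect Q" by auto
    then show ?thesis using that by simp
  qed
  show ?case
  proof (cases "\<exists>w\<in>V. v \<bullet> w \<noteq> 0")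
    case False
    \<comment> \<open>Here \<open>v\<close> vanishes on \<open>V\<close>: no sign vector is
      realized, and Whitney's sum is a difference of two equal polynomials.\<close>
    have "open_cell V (insert v A) S = {}" if "S \<subseteq> insert v A" for S
    proof (rule ccontr)
      assume "open_cell V (insert v A) S \<noteq> {}"
      then obtain y where y: "y \<in> open_cell V (insert v A) S" by auto
      then have "v \<bullet> y = 0" using False by (auto simp: open_cell_def)
      then show False using y by (cases "v \<in> S") (force simp: open_cell_def)+
    qed
    moreover have "?H = V" using False by (auto simp: perp_def)
    ultimately show ?thesis
      by (simp add: whitney_poly_insert[OF insert(1,2)] projects_to_dim_def cong: conj_cong)
  next
    case True
    then obtain w where w: "w \<in> V" "v \<bullet> w \<noteq> 0" by auto
    have "int (card {S \<in> Pow (insert v A). projects_to_dim V (insert v A) x k S})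
      = (\<Sum>S\<in>Pow A. of_bool (projects_to_dim V (insert v A) x k S)
           + of_bool (projects_to_dim V (insert v A) x k (insert v S)))"
      using insert(1) by (simp add: count sum_Pow_insert[OF insert(1,2)] del: Pow_iff)
    also have "\<dots> = (\<Sum>S\<in>Pow A. of_bool (projects_to_dim V A x k S)
           + of_bool (projects_to_dim ?H A x k S))"
      using insert w by (intro sum.cong refl projects_to_dim_insert) auto
    also have "\<dots> = int (card {S \<in> Pow A. projects_to_dim V A x k S})
           + int (card {S \<in> Pow A. projects_to_dim ?H A x k S})"
      by (simp only: count[OF insert(1)] sum.distrib)
    also have "\<dots> = (-1) ^ (dim V + k) * coeff (whitney_poly V A) k
           + (-1) ^ (dim ?H + k) * coeff (whitney_poly ?H A) k"
      using insert.IH[OF insert(4)] insert.IH[OF subspace_perp[OF insert(4)]]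
        generic_subset[OF insert(5)] generic_restrict[OF insert(5)] by auto
    \<comment> \<open>The restriction has dimension one less, and this flips the sign as the minus
      in \<open>whitney_poly_insert\<close> demands.\<close>
    also have "\<dots> = (-1) ^ (dim V + k) * coeff (whitney_poly V (insert v A)) k"
      using dim_perp_singleton[OF insert(4) w]
      by (simp add: whitney_poly_insert[OF insert(1,2)] algebra_simps)
    finally show ?thesis .
  qed
qed

text \<open>For a flat \<open>L\<close> and a normal \<open>v\<close> not vanishing on it, failure
  of genericity confines \<open>x\<close> to the hyperplane whose normal is the component
  \<open>a\<close> of \<open>v\<close> in \<open>L\<close>. There are finitely many such
  pairs.\<close>

lemma negligible_not_generic:
  assumes "finite A" "subspace V"
  shows "negligible {x. \<not> generic V A x}"
proof -
  have one: "\<exists>a. a \<noteq> 0 \<and> (\<forall>x. \<forall>y\<in>L. (\<forall>z\<in>L. (x - y) \<bullet> z = 0) \<longrightarrow> v \<bullet> y = 0 \<longrightarrow> a \<bullet> x = 0)"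
    if L: "subspace L" and w: "w \<in> L" "v \<bullet> w \<noteq> 0" for L and v w :: 'a
  proof -
    obtain a b where ab: "a \<in> span L" "\<And>z. z \<in> span L \<Longrightarrow> orthogonal b z" "v = a + b"
      using orthogonal_subspace_decomp_exists by blast
    have b: "b \<bullet> z = 0" if "z \<in> L" for z
      using ab(2)[of z] that by (simp add: span_base orthogonal_def)
    have a: "a \<in> L" using ab(1) L by (simp add: span_eq_iff[THEN iffD2])
    have "a \<noteq> 0" using w b[OF w(1)] ab(3) by auto
    moreover have "a \<bullet> x = 0" if "y \<in> L" "\<forall>z\<in>L. (x - y) \<bullet> z = 0" "v \<bullet> y = 0" for x y
    proof -
      have "a \<bullet> y = 0" using that(3) b[OF that(1)] by (simp add: ab(3) inner_left_distrib)
      moreover have "a \<bullet> (x - y) = 0" using that(2) a by (simp add: inner_commute)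
      ultimately show ?thesis by (simp add: inner_diff_right)
    qed
    ultimately show ?thesis by blast
  qed
  define bad where "bad T v = {x. \<exists>y\<in>perp V T. (\<forall>z\<in>perp V T. (x - y) \<bullet> z = 0) \<and> v \<bullet> y = 0
      \<and> (\<exists>w\<in>perp V T. v \<bullet> w \<noteq> 0)}" for T v
  have "negligible (bad T v)" for T v
  proof (cases "\<exists>w\<in>perp V T. v \<bullet> w \<noteq> 0")
    case True
    then obtain w where "w \<in> perp V T" "v \<bullet> w \<noteq> 0" by auto
    from one[OF subspace_perp[OF assms(2)] this] obtain a where a: "a \<noteq> 0"
      "\<forall>x. \<forall>y\<in>perp V T. (\<forall>z\<in>perp V T. (x - y) \<bullet> z = 0) \<longrightarrow> v \<bullet> y = 0 \<longrightarrow> a \<bullet> x = 0"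
      by auto
    then have "bad T v \<subseteq> {x. a \<bullet> x = 0}" unfolding bad_def by auto
    then show ?thesis using a(1) by (metis negligible_hyperplane negligible_subset)
  qed (auto simp: bad_def)
  then have "negligible (\<Union>(case_prod bad ` (Pow A \<times> A)))"
    using assms(1) by (intro negligible_Union) auto
  moreover have "{x. \<not> generic V A x} \<subseteq> \<Union>(case_prod bad ` (Pow A \<times> A))"
  proof clarify
    fix x assume "\<not> generic V A x"
    then obtain T v where "T \<subseteq> A" "v \<in> A" "x \<in> bad T v"
      unfolding generic_def bad_def by blast
    then show "x \<in> \<Union>(case_prod bad ` (Pow A \<times> A))"
      by (intro UnionI[of "bad T v"] image_eqI[of _ _ "(T, v)"]) auto
  qed
  ultimately show ?thesis by (rule negligible_subset)
qed

text \<open>The face is the slice \<open>F\<close> of the cell by the flat of all hyperplanes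
  through \<open>z\<close>. On a neighbourhood \<open>U\<close> of \<open>z\<close> the other
  inequalities persist, so \<open>F\<close> fills the flat there and has its dimension. Uniqueness
  holds because faces whose relative interiors meet coincide.\<close>

lemma in_face_of_dim_cell:
  assumes A: "finite A" and z: "z \<in> cell UNIV A S" and S: "S \<subseteq> A"
  shows "in_face_of_dim (cell UNIV A S) k z \<longleftrightarrow> face_dim UNIV A z = k"
proof -
  let ?P = "cell UNIV A S"
  define L where "L = perp UNIV {v \<in> A. v \<bullet> z = 0}"
  define F where "F = ?P \<inter> L"
  have L: "subspace L" unfolding L_def by (rule subspace_perp) simp
  have zF: "z \<in> F" using z by (auto simp: F_def L_def perp_def)
  have face: "F face_of ?P"
    unfolding face_of_def
  proof (intro conjI ballI impI)
    show "F \<subseteq> ?P" by (simp add: F_def)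
    show "convex F"
      unfolding F_def by (intro convex_Int convex_cell subspace_imp_convex L) simp
    fix a b c assume ab: "a \<in> ?P" "b \<in> ?P" and c: "c \<in> F" "c \<in> open_segment a b"
    then obtain u where u: "0 < u" "u < 1" "c = (1 - u) *\<^sub>R a + u *\<^sub>R b"
      by (auto simp: in_segment)
    have "v \<bullet> a = 0 \<and> v \<bullet> b = 0" if v: "v \<in> A" "v \<bullet> z = 0" for v
    proof -
      have sum0: "(1 - u) * (v \<bullet> a) + u * (v \<bullet> b) = 0"
        using c(1) v u(3) by (auto simp: F_def L_def perp_def inner_right_distrib)
      show ?thesis
      proof (cases "v \<in> S")
        case True
        then have "v \<bullet> a \<ge> 0" "v \<bullet> b \<ge> 0" using ab by (auto simp: cell_def)
        then show ?thesis using sum0 u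
          by (smt (verit) mult_pos_pos mult_nonneg_nonneg)
      next
        case False
        then have "v \<bullet> a \<le> 0" "v \<bullet> b \<le> 0" using ab v by (auto simp: cell_def)
        then show ?thesis using sum0 u
          by (smt (verit) mult_pos_neg mult_nonneg_nonpos)
      qed
    qed
    then show "a \<in> F" "b \<in> F" using ab by (auto simp: F_def L_def perp_def)
  qed
  define U where "U = (\<Inter>v\<in>A. if v \<bullet> z > 0 then {y. v \<bullet> y > 0} else if v \<bullet> z < 0 then {y. v \<bullet> y < 0} else UNIV)"
  have U: "open U" "z \<in> U"
    using A by (auto simp: U_def open_halfspace_gt open_halfspace_lt)
  have UL: "U \<inter> L \<subseteq> F"
  proof
    fix y assume y: "y \<in> U \<inter> L"
    then have yU: "y \<in> U" and yL: "y \<in> L" by auto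
    have side: "(v \<bullet> z > 0 \<longrightarrow> v \<bullet> y > 0) \<and> (v \<bullet> z < 0 \<longrightarrow> v \<bullet> y < 0)" if "v \<in> A" for v
      using INT_D[OF yU[unfolded U_def] that] by (auto split: if_splits)
    have null: "v \<bullet> z = 0 \<Longrightarrow> v \<bullet> y = 0" if "v \<in> A" for v
      using that yL by (auto simp: L_def perp_def)
    have "v \<bullet> y \<ge> 0" if "v \<in> S" for v
      using that S side[of v] null[of v] z by (cases "v \<bullet> z = 0") (auto simp: cell_def less_le)
    moreover have "v \<bullet> y \<le> 0" if "v \<in> A - S" for v
      using that S side[of v] null[of v] z by (cases "v \<bullet> z = 0") (auto simp: cell_def less_le)
    ultimately show "y \<in> F" using y by (auto simp: F_def cell_def)
  qed
  have "affine hull F \<subseteq> L"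
    using L by (intro hull_minimal) (auto simp: F_def subspace_imp_affine)
  then have rel: "z \<in> rel_interior F"
    using U zF UL by (auto simp: rel_interior)
  have "aff_dim (L \<inter> U) = aff_dim L"
    using U zF L by (intro aff_dim_convex_Int_open subspace_imp_convex) (auto simp: F_def)
  moreover have "aff_dim (L \<inter> U) \<le> aff_dim F" "aff_dim F \<le> aff_dim L"
    using UL by (auto intro!: aff_dim_subset simp: F_def)
  moreover have "aff_dim L = int (dim L)" using L by (rule aff_dim_subspace)
  ultimately have dimF: "aff_dim F = int (dim L)" by simp
  have "G = F" if "G face_of ?P" "z \<in> rel_interior G" for G
    using face_of_eq[OF that(1) face] that(2) rel by auto
  then show ?thesis
    using face rel dimF unfolding in_face_of_dim_def face_dim_def L_def[symmetric]
    by (metis of_nat_eq_iff)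
qed

subsection \<open>Whitney's formula for the characteristic polynomial\<close>

text \<open>For a fixed \<open>v\<close>, the terms of \<open>T\<close> and
  \<open>insert v T\<close> cancel.\<close>

lemma alternating_sum_Pow:
  assumes "finite A" "A \<noteq> {}"
  shows "(\<Sum>T\<in>Pow A. (-1) ^ card T) = (0::int)"
proof -
  obtain v B where B: "A = insert v B" "v \<notin> B" using assms(2) by (meson Set.set_insert ex_in_conv)
  then have fB: "finite B" using assms(1) by simp
  have "(\<Sum>T\<in>Pow A. (-1) ^ card T) = (\<Sum>T\<in>Pow B. (-1) ^ card T + (-1::int) ^ card (insert v T))"
    unfolding B(1) by (rule sum_Pow_insert[OF fB B(2)])
  also have "\<dots> = 0"
  proof (intro sum.neutral ballI)
    fix T assume "T \<in> Pow B"
    then have "card (insert v T) = Suc (card T)"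
      using fB B(2) by (auto intro!: card_insert_disjoint intro: finite_subset)
    then show "(-1) ^ card T + (-1::int) ^ card (insert v T) = 0" by simp
  qed
  finally show ?thesis .
qed

text \<open>Summed over the flats containing \<open>y\<close>, the right-hand side runs over all
  subsets of the set of hyperplanes containing \<open>y\<close>. For \<open>y \<noteq> UNIV\<close>
  this set is nonempty and the sum vanishes, which is the recursion of \<open>flat_mobius\<close>.
  As \<open>UNIV\<close> is not in \<open>A\<close>, only the empty subset has intersection
  \<open>UNIV\<close>.\<close>

lemma flat_mobius_eq:
  assumes "finite A" "UNIV \<notin> A" "y \<in> flats A"
  shows "flat_mobius A y = (\<Sum>T\<in>{T \<in> Pow A. \<Inter>T = y}. (-1) ^ card T)"
  using assms
proof (induction A y rule: flat_mobius.induct)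
  case (1 A y)
  let ?m = "\<lambda>y. \<Sum>T\<in>{T \<in> Pow A. \<Inter>T = y}. (-1::int) ^ card T"
  show ?case
  proof (cases "y = UNIV")
    case True
    then have "{T \<in> Pow A. \<Inter>T = y} = {{}}" using 1(3) by auto
    then show ?thesis using True 1(2) by (simp add: flat_mobius_UNIV)
  next
    case False
    have fin: "finite (flats A)" using 1(2) by (rule finite_flats)
    have "(\<Sum>z\<in>{z \<in> flats A. y \<subseteq> z}. ?m z)
        = (\<Sum>z\<in>{z \<in> flats A. y \<subseteq> z}. \<Sum>T\<in>{T \<in> Pow {H \<in> A. y \<subseteq> H}. \<Inter>T = z}. (-1) ^ card T)"
      by (intro sum.cong refl) auto
    also have "\<dots> = (\<Sum>T\<in>Pow {H \<in> A. y \<subseteq> H}. (-1) ^ card T)"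
      using 1(2) fin by (intro sum.group) (auto simp: flats_def)
    also have "\<dots> = 0"
      using 1(2,4) False by (intro alternating_sum_Pow) (auto simp: flats_def)
    finally have "(\<Sum>z\<in>{z \<in> flats A. y \<subseteq> z}. ?m z) = 0" .
    moreover have "{z \<in> flats A. y \<subseteq> z} = insert y {z \<in> flats A. y \<subset> z}"
      using 1(4) by auto
    ultimately have "?m y = - (\<Sum>z\<in>{z \<in> flats A. y \<subset> z}. ?m z)"
      using fin by simp
    also have "\<dots> = - (\<Sum>z\<in>{z \<in> flats A. y \<subset> z}. flat_mobius A z)"
      using 1 False by (intro arg_cong[of _ _ uminus] sum.cong refl) auto
    also have "\<dots> = flat_mobius A y"
      using 1(2) False by (simp add: flat_mobius.simps[of A y])
    finally show ?thesis ..
  qed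
qed

lemma arrangement_charpoly_whitney:
  assumes "finite A" "UNIV \<notin> A"
  shows "arrangement_charpoly A = (\<Sum>T\<in>Pow A. monom ((-1) ^ card T) (dim (\<Inter>T)))"
proof -
  have "arrangement_charpoly A
      = (\<Sum>y\<in>flats A. \<Sum>T\<in>{T \<in> Pow A. \<Inter>T = y}. monom ((-1) ^ card T) (dim (\<Inter>T)))"
    unfolding arrangement_charpoly_def
    by (intro sum.cong refl) (simp add: flat_mobius_eq[OF assms] monom_sum)
  also have "\<dots> = (\<Sum>T\<in>Pow A. monom ((-1) ^ card T) (dim (\<Inter>T)))"
    using assms by (intro sum.group finite_flats) (auto simp: flats_def)
  finally show ?thesis .
qed

text \<open>The linear bijection \<open>D\<close> carries each intersection of members of
  \<open>A\<close> to the flat of the corresponding normals and preserves its dimension, so the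
  subset sums agree term by term.\<close>

lemma whitney_poly_normals:
  assumes "finite A" "linear D" "bij D"
    and u: "\<And>H. H \<in> A \<Longrightarrow> u H \<noteq> 0" "\<And>H. H \<in> A \<Longrightarrow> {x. u H \<bullet> x = 0} = D ` H"
  shows "whitney_poly UNIV (u ` A) = arrangement_charpoly A"
proof -
  have "UNIV \<notin> A"
  proof
    assume U: "UNIV \<in> A"
    have "u UNIV \<in> {x. u UNIV \<bullet> x = 0}"
      unfolding u(2)[OF U] using assms(3) by (simp add: bij_is_surj)
    then show False using u(1)[OF U] by simp
  qed
  have inj: "inj_on u A"
    using u(2) assms(3) by (metis bij_is_inj inj_image_eq_iff inj_onI)
  have "whitney_poly UNIV (u ` A) = (\<Sum>T\<in>Pow A. monom ((-1) ^ card (u ` T)) (dim (perp UNIV (u ` T))))"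
    unfolding whitney_poly_def image_Pow_surj[OF refl, symmetric]
    by (subst sum.reindex) (simp_all add: inj_on_image_Pow inj)
  also have "\<dots> = (\<Sum>T\<in>Pow A. monom ((-1) ^ card T) (dim (\<Inter>T)))"
  proof (intro sum.cong refl)
    fix T assume T: "T \<in> Pow A"
    have "perp UNIV (u ` T) = (\<Inter>H\<in>T. {x. u H \<bullet> x = 0})" by (auto simp: perp_def)
    also have "\<dots> = (\<Inter>H\<in>T. D ` H)"
      using T u(2) by (intro INF_cong) auto
    also have "\<dots> = D ` \<Inter>T" using bij_image_INT[OF assms(3), of id T] by simp
    finally have "dim (perp UNIV (u ` T)) = dim (\<Inter>T)"
      using dim_image_eq[OF assms(2) inj_on_subset[OF bij_is_inj[OF assms(3)] subset_UNIV]] by simp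
    moreover have "card (u ` T) = card T"
      using T inj by (intro card_image) (auto intro: inj_on_subset)
    ultimately show "monom ((-1) ^ card (u ` T)) (dim (perp UNIV (u ` T)))
        = monom ((-1::int) ^ card T) (dim (\<Inter>T))" by simp
  qed
  also have "\<dots> = arrangement_charpoly A"
    by (rule arrangement_charpoly_whitney[symmetric]) fact+
  finally show ?thesis .
qed

lemma in_face_of_dim_linear_image:
  assumes "linear f" "inj f"
  shows "in_face_of_dim (f ` C) k (f z) \<longleftrightarrow> in_face_of_dim C k z"
proof
  assume "in_face_of_dim C k z"
  then obtain F where "F face_of C" "aff_dim F = int k" "z \<in> rel_interior F"
    by (auto simp: in_face_of_dim_def)
  then show "in_face_of_dim (f ` C) k (f z)"
    using assms unfolding in_face_of_dim_def
    by (intro exI[of _ "f ` F"])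
      (simp add: face_of_linear_image aff_dim_injective_linear_image
        rel_interior_injective_linear_image linear_conv_bounded_linear)
next
  assume "in_face_of_dim (f ` C) k (f z)"
  then obtain G where G: "G face_of f ` C" "aff_dim G = int k" "f z \<in> rel_interior G"
    by (auto simp: in_face_of_dim_def)
  obtain F where F: "G = f ` F"
    using face_of_imp_subset[OF G(1)] by (auto simp: subset_image_iff)
  have "z \<in> rel_interior F"
    using G(3) assms unfolding F
    by (simp add: rel_interior_injective_linear_image inj_image_mem_iff linear_conv_bounded_linear)
  then show "in_face_of_dim C k z"
    using G(1,2) assms unfolding F in_face_of_dim_def
    by (intro exI[of _ F]) (simp add: face_of_linear_image aff_dim_injective_linear_image)
qed

subsection \<open>Reflection groups acting simply transitively on chambers\<close>

text \<open>Not normalized: a nonzero multiple of a member defines the same reflection and is a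
  member too. The set is thus infinite unless empty, and \<open>card_chamber_projections\<close>
  picks one root per mirror.\<close>

definition roots :: "('a::euclidean_space \<Rightarrow> 'a) set \<Rightarrow> 'a set" where
  "roots W = {v. v \<noteq> 0 \<and> reflection v \<in> W}"

lemma fixed_points_reflection: "v \<noteq> 0 \<Longrightarrow> {x. reflection v x = x} = {x. v \<bullet> x = 0}"
  by (auto simp: reflection_def)

lemma reflection_arrangement_roots:
  "reflection_arrangement W = (\<lambda>v. {x. v \<bullet> x = 0}) ` roots W"
proof -
  have "reflection_arrangement W = (\<lambda>v. {x. reflection v x = x}) ` roots W"
    by (auto simp: reflection_arrangement_def roots_def)
  also have "\<dots> = (\<lambda>v. {x. v \<bullet> x = 0}) ` roots W"
    by (intro image_cong refl fixed_points_reflection) (auto simp: roots_def)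
  finally show ?thesis .
qed

text \<open>A component cannot cross a mirror, while the points strictly on the side of
  \<open>a\<close> form a convex set avoiding all mirrors, so the two agree. The factor
  \<open>v \<bullet> a\<close> makes the condition independent of the sign of the root.\<close>

lemma fundamental_chamber_halfspaces:
  assumes "fundamental_chamber W C"
  obtains a where "\<And>v. v \<in> roots W \<Longrightarrow> v \<bullet> a \<noteq> 0"
    and "C = {y. \<forall>v\<in>roots W. (v \<bullet> a) * (v \<bullet> y) \<ge> 0}"
proof -
  let ?M = "- \<Union>(reflection_arrangement W)"
  obtain R where R: "R \<in> components ?M" "C = closure R"
    using assms by (auto simp: fundamental_chamber_def)
  then obtain a where a: "a \<in> R" using in_components_nonempty by blast
  have M: "?M = {y. \<forall>v\<in>roots W. v \<bullet> y \<noteq> 0}"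
    by (auto simp: reflection_arrangement_roots)
  have RM: "R \<subseteq> ?M" "connected R" using R in_components_subset in_components_connected by blast+
  have reg: "v \<bullet> a \<noteq> 0" if "v \<in> roots W" for v using RM(1) M a that by auto
  let ?O = "{y. \<forall>v\<in>roots W. (v \<bullet> a) * (v \<bullet> y) > 0}"
  have "R = ?O"
  proof
    show "R \<subseteq> ?O"
    proof (clarify, rule ccontr)
      fix y v assume y: "y \<in> R" and v: "v \<in> roots W" and "\<not> (v \<bullet> a) * (v \<bullet> y) > 0"
      moreover have "v \<bullet> y \<noteq> 0" using RM(1) M y v by auto
      ultimately have "(v \<bullet> a \<le> 0 \<and> 0 \<le> v \<bullet> y) \<or> (v \<bullet> y \<le> 0 \<and> 0 \<le> v \<bullet> a)"
        by (auto simp: zero_less_mult_iff not_less)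
      then obtain z where "z \<in> R" "v \<bullet> z = 0"
        using connected_ivt_hyperplane[OF RM(2) a y, of v 0] connected_ivt_hyperplane[OF RM(2) y a, of v 0]
        by blast
      then show False using RM(1) M v by auto
    qed
    have "convex ?O"
    proof -
      have "?O = (\<Inter>v\<in>roots W. {y. ((v \<bullet> a) *\<^sub>R v) \<bullet> y > 0})" by auto
      then show ?thesis by (simp only:) (intro convex_INT convex_halfspace_gt)
    qed
    moreover have "?O \<subseteq> ?M" unfolding M by force
    moreover have "R \<inter> ?O \<noteq> {}" using a reg by (auto simp: zero_less_mult_iff less_le)
    ultimately show "?O \<subseteq> R"
      using components_maximal[OF R(1)] convex_connected by blast
  qed
  moreover have "closure ?O = {y. \<forall>v\<in>roots W. (v \<bullet> a) * (v \<bullet> y) \<ge> 0}" (is "_ = ?P")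
  proof
    have "?P = (\<Inter>v\<in>roots W. {y. ((v \<bullet> a) *\<^sub>R v) \<bullet> y \<ge> 0})" by auto
    then have "closed ?P" by (simp only:) (intro closed_INT ballI closed_halfspace_ge)
    then show "closure ?O \<subseteq> ?P" by (intro closure_minimal) (auto intro: less_imp_le)
    show "?P \<subseteq> closure ?O"
    proof
      fix y assume y: "y \<in> ?P"
      have "\<exists>z\<in>?O. dist z y < e" if e: "e > 0" for e
      proof
        define t where "t = e / (2 * (norm a + 1))"
        have t: "t > 0" using e by (simp add: t_def add_nonneg_pos)
        show "y + t *\<^sub>R a \<in> ?O"
        proof clarify
          fix v assume v: "v \<in> roots W"
          have "t * ((v \<bullet> a) * (v \<bullet> a)) > 0" using t reg[OF v] by (simp add: zero_less_mult_iff) linarith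
          moreover have "(v \<bullet> a) * (v \<bullet> y) \<ge> 0" using y v by auto
          ultimately show "(v \<bullet> a) * (v \<bullet> (y + t *\<^sub>R a)) > 0"
            by (simp add: inner_right_distrib algebra_simps)
        qed
        have "t * norm a < t * (2 * (norm a + 1))"
          using t by (simp add: mult_strict_left_mono) (smt (verit) norm_ge_zero)
        also have "\<dots> = e" by (simp add: t_def) (smt (verit) norm_ge_zero)
        finally show "dist (y + t *\<^sub>R a) y < e" using t by (simp add: dist_norm)
      qed
      then show "y \<in> closure ?O" by (simp add: closure_approachable)
    qed
  qed
  ultimately show thesis using that reg R(2) by auto
qed

text \<open>The properties of types A and B from which the count follows. In
  \<open>stabilizer_trivial\<close>, positivity says that \<open>b\<close> lies on no mirror and
  that \<open>g b\<close> is in the chamber of \<open>b\<close>.\<close>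

locale mirror_group =
  fixes W :: "('a::euclidean_space \<Rightarrow> 'a) set"
  assumes fin: "finite W" and id_mem: "id \<in> W"
    and orth: "g \<in> W \<Longrightarrow> orthogonal_transformation g"
    and comp_mem: "g \<in> W \<Longrightarrow> h \<in> W \<Longrightarrow> g \<circ> h \<in> W"
    and inv_mem: "g \<in> W \<Longrightarrow> inv g \<in> W"
    and stabilizer_trivial:
      "g \<in> W \<Longrightarrow> (\<And>v. v \<in> roots W \<Longrightarrow> (v \<bullet> b) * (v \<bullet> g b) > 0) \<Longrightarrow> g = id"
begin

lemma bij_mem: "g \<in> W \<Longrightarrow> bij g"
  using orth orthogonal_transformation_bij by blast

lemma inner_mem: "g \<in> W \<Longrightarrow> g x \<bullet> g y = x \<bullet> y"
  using orth by (simp add: orthogonal_transformation_def)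

lemma inner_inv: "g \<in> W \<Longrightarrow> x \<bullet> inv g y = g x \<bullet> y"
  by (metis inner_mem bij_mem bij_inv_eq_iff)

lemma inner_mem_left: "g \<in> W \<Longrightarrow> x \<bullet> g y = inv g x \<bullet> y"
  by (metis inner_mem bij_mem bij_inv_eq_iff)

text \<open>Conjugating the reflection in \<open>v\<close> by \<open>g\<close> gives the reflection
  in \<open>g v\<close>.\<close>

lemma root_image:
  assumes "g \<in> W" "v \<in> roots W"
  shows "g v \<in> roots W"
proof -
  have lin: "linear g" using orth[OF assms(1)] by (simp add: orthogonal_transformation_def)
  have "reflection (g v) = g \<circ> reflection v \<circ> inv g"
  proof
    fix x
    have "g (inv g x) = x" using bij_mem[OF assms(1)] by (simp add: bij_is_surj surj_f_inv_f)
    then show "reflection (g v) x = (g \<circ> reflection v \<circ> inv g) x"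
      using assms(1) lin
      by (simp add: reflection_def linear_diff linear_scale inner_mem inner_inv)
  qed
  moreover have "g v \<noteq> 0"
    using inner_mem[OF assms(1), of v v] assms(2) by (auto simp: roots_def)
  ultimately show ?thesis
    using assms comp_mem inv_mem by (auto simp: roots_def)
qed

text \<open>Among the points \<open>g b\<close>, one closest to \<open>a\<close> lies in the chamber of \<open>a\<close>: a mirror separating
  the two could be used to reflect \<open>g b\<close> closer to \<open>a\<close>.\<close>

lemma transitive_on_chambers:
  assumes a: "\<And>v. v \<in> roots W \<Longrightarrow> v \<bullet> a \<noteq> 0" and b: "\<And>v. v \<in> roots W \<Longrightarrow> v \<bullet> b \<noteq> 0"
  shows "\<exists>g\<in>W. \<forall>v\<in>roots W. (v \<bullet> a) * (v \<bullet> g b) > 0"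
proof -
  \<comment> \<open>All points \<open>h b\<close> have the same norm, so closest to \<open>a\<close>
    means largest inner product with \<open>a\<close>.\<close>
  obtain g where g: "g \<in> W" "\<And>h. h \<in> W \<Longrightarrow> a \<bullet> h b \<le> a \<bullet> g b"
  proof -
    have "Max ((\<lambda>h. a \<bullet> h b) ` W) \<in> (\<lambda>h. a \<bullet> h b) ` W"
      using fin id_mem by (intro Max_in) auto
    then obtain g where "g \<in> W" "a \<bullet> g b = Max ((\<lambda>h. a \<bullet> h b) ` W)"
      by (metis (no_types, lifting) imageE)
    then show thesis using that fin by simp
  qed
  have "(v \<bullet> a) * (v \<bullet> g b) > 0" if v: "v \<in> roots W" for v
  proof -
    have "reflection v \<circ> g \<in> W" using v g(1) comp_mem by (auto simp: roots_def)
    from g(2)[OF this] have "2 * (v \<bullet> g b) / (v \<bullet> v) * (a \<bullet> v) \<ge> 0"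
      by (simp add: reflection_def inner_diff_right)
    moreover have "v \<bullet> v > 0" using v by (auto simp: roots_def)
    ultimately have "(v \<bullet> a) * (v \<bullet> g b) \<ge> 0"
      by (simp add: zero_le_divide_iff inner_commute mult.commute)
    moreover have "v \<bullet> g b \<noteq> 0"
      using b[OF root_image[OF inv_mem[OF g(1)] v]] inner_mem_left[OF g(1)] by simp
    ultimately show ?thesis using a[OF v] by (simp add: less_le)
  qed
  then show ?thesis using g(1) by blast
qed

text \<open>By \<open>adj\<close>, the image under \<open>D\<close> of the mirror with normal
  \<open>v\<close> has normal \<open>E v\<close>. Each \<open>g\<close> is matched with the sign
  vector \<open>S g\<close> of the chamber obtained from \<open>C\<close> by \<open>inv g\<close>
  followed by \<open>D\<close>. This is injective by \<open>stabilizer_trivial\<close> and reaches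
  every realized sign vector by \<open>transitive_on_chambers\<close>.\<close>

lemma card_chamber_projections:
  fixes a :: 'a and C :: "'a set" and D E :: "'a \<Rightarrow> 'a"
  assumes a: "\<And>v. v \<in> roots W \<Longrightarrow> v \<bullet> a \<noteq> 0"
    and C: "C = {y. \<forall>v\<in>roots W. (v \<bullet> a) * (v \<bullet> y) \<ge> 0}"
    and D: "linear D" and E: "linear E" and DE: "\<And>x. D (E x) = x" "\<And>x. E (D x) = x"
    and adj: "\<And>x y. E x \<bullet> D y = x \<bullet> y"
  shows "\<exists>N. finite N \<and> (\<forall>x k. generic UNIV N (D x) \<longrightarrow>
    int (card {g \<in> W. in_face_of_dim C k (g (E (closest_point (D ` inv g ` C) (D x))))})
      = \<bar>coeff (arrangement_charpoly (reflection_arrangement W)) k\<bar>)"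
proof -
  let ?A = "reflection_arrangement W"
  have finA: "finite ?A" using fin by (rule finite_reflection_arrangement)
  have "\<forall>H\<in>?A. \<exists>v. v \<in> roots W \<and> H = {x. v \<bullet> x = 0}"
    by (auto simp: reflection_arrangement_roots)
  \<comment> \<open>One root per mirror gives a finite set of normals in bijection with the
    mirrors.\<close>
  then obtain n where n: "\<And>H. H \<in> ?A \<Longrightarrow> n H \<in> roots W" "\<And>H. H \<in> ?A \<Longrightarrow> H = {x. n H \<bullet> x = 0}"
    by metis
  let ?N = "n ` ?A"
  define N where "N = (\<lambda>H. E (n H)) ` ?A"
  have N_eq: "N = E ` ?N" by (auto simp: N_def)
  have finN: "finite N" using finA by (simp add: N_def)
  have bijD: "bij D" using DE by (intro o_bij[of E]) auto
  have injE: "inj E" using DE by (metis injI)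
  have N_roots: "?N \<subseteq> roots W" using n(1) by auto
  have adj': "E v \<bullet> y = v \<bullet> E y" for v y using adj[of v "E y"] DE by simp
  \<comment> \<open>The remainder \<open>?r\<close> is orthogonal to \<open>?u\<close>, hence to
    \<open>v\<close> because both have the same mirror, hence to itself.\<close>
  have multiple: "\<exists>u\<in>?N. \<exists>c. c \<noteq> 0 \<and> v = c *\<^sub>R u" if v: "v \<in> roots W" for v
  proof -
    let ?H = "{x. v \<bullet> x = 0}"
    let ?u = "n ?H"
    have H: "?H \<in> ?A" using v by (auto simp: reflection_arrangement_roots)
    have ker: "{x. v \<bullet> x = 0} = {x. ?u \<bullet> x = 0}" using n(2)[OF H] .
    have u: "?u \<bullet> ?u \<noteq> 0" using n(1)[OF H] by (simp add: roots_def)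
    let ?c = "(v \<bullet> ?u) / (?u \<bullet> ?u)"
    let ?r = "v - ?c *\<^sub>R ?u"
    have "?u \<bullet> ?r = 0" using u by (simp add: inner_diff_right inner_commute)
    then have "v \<bullet> ?r = 0" using ker by auto
    then have "?r \<bullet> ?r = 0" using \<open>?u \<bullet> ?r = 0\<close> by (simp add: inner_diff_left)
    then have "v = ?c *\<^sub>R ?u" by simp
    moreover have "?c \<noteq> 0" using calculation v by (auto simp: roots_def)
    ultimately show ?thesis using H by blast
  qed
  \<comment> \<open>Scaling a root by \<open>c\<close> scales the product by \<open>c * c\<close>,
    so conditions stable under positive scaling can be tested on the chosen roots.\<close>
  have all_roots: "(\<forall>v\<in>roots W. P ((v \<bullet> y) * (v \<bullet> z))) \<longleftrightarrow> (\<forall>v\<in>?N. P ((v \<bullet> y) * (v \<bullet> z)))"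
    if P: "\<And>c r. c > 0 \<Longrightarrow> P r \<Longrightarrow> P (c * r)" for P :: "real \<Rightarrow> bool" and y z
  proof
    assume L: "\<forall>v\<in>?N. P ((v \<bullet> y) * (v \<bullet> z))"
    show "\<forall>v\<in>roots W. P ((v \<bullet> y) * (v \<bullet> z))"
    proof
      fix v assume "v \<in> roots W"
      then obtain u c where u: "u \<in> ?N" "c \<noteq> 0" "v = c *\<^sub>R u" using multiple by blast
      then have "(v \<bullet> y) * (v \<bullet> z) = (c * c) * ((u \<bullet> y) * (u \<bullet> z))" by simp
      then show "P ((v \<bullet> y) * (v \<bullet> z))"
        using P[of "c * c"] L u by (metis not_real_square_gt_zero)
    qed
  qed (use N_roots in blast)
  have same_side: "(\<forall>v\<in>roots W. (v \<bullet> y) * (v \<bullet> z) > 0) \<longleftrightarrow> (\<forall>v\<in>?N. (v \<bullet> y) * (v \<bullet> z) > 0)" for y z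
    by (rule all_roots[of "\<lambda>r. r > 0"]) simp
  have weak_side: "(\<forall>v\<in>roots W. (v \<bullet> y) * (v \<bullet> z) \<ge> 0) \<longleftrightarrow> (\<forall>v\<in>?N. (v \<bullet> y) * (v \<bullet> z) \<ge> 0)" for y z
    by (rule all_roots[of "\<lambda>r. r \<ge> 0"]) simp
  have move: "(\<forall>v\<in>roots W. P (v \<bullet> y) (v \<bullet> g z)) \<longleftrightarrow> (\<forall>v\<in>roots W. P (v \<bullet> inv g y) (v \<bullet> z))"
    if g: "g \<in> W" for g y z and P :: "real \<Rightarrow> real \<Rightarrow> bool"
  proof
    assume "\<forall>v\<in>roots W. P (v \<bullet> y) (v \<bullet> g z)"
    then show "\<forall>v\<in>roots W. P (v \<bullet> inv g y) (v \<bullet> z)"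
      using root_image[OF g] inner_inv[OF g] inner_mem[OF g] by metis
  next
    assume L: "\<forall>v\<in>roots W. P (v \<bullet> inv g y) (v \<bullet> z)"
    show "\<forall>v\<in>roots W. P (v \<bullet> y) (v \<bullet> g z)"
    proof
      fix v assume "v \<in> roots W"
      then have "P (inv g v \<bullet> inv g y) (inv g v \<bullet> z)"
        using L root_image[OF inv_mem[OF g]] by blast
      then show "P (v \<bullet> y) (v \<bullet> g z)"
        using inner_mem[OF inv_mem[OF g]] inner_mem_left[OF g] by simp
    qed
  qed
  define S where "S g = {u \<in> N. u \<bullet> D (inv g a) > 0}" for g
  have S_alt: "S g = E ` {v \<in> ?N. v \<bullet> inv g a > 0}" for g
    unfolding S_def N_eq by (auto simp: adj)
  have reg_inv: "v \<bullet> inv g a \<noteq> 0" if "g \<in> W" "v \<in> roots W" for g v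
    using that a[OF root_image[OF that]] inner_inv by simp
  have cell_eq: "cell UNIV N (S g) = D ` inv g ` C" if g: "g \<in> W" for g
  proof -
    have "y \<in> cell UNIV N (S g) \<longleftrightarrow> g (E y) \<in> C" for y
    proof -
      have "g (E y) \<in> C \<longleftrightarrow> (\<forall>v\<in>roots W. (v \<bullet> inv g a) * (v \<bullet> E y) \<ge> 0)"
        unfolding C mem_Collect_eq by (rule move[OF g, of "\<lambda>r s. r * s \<ge> 0"])
      also have "\<dots> \<longleftrightarrow> (\<forall>v\<in>?N. (v \<bullet> inv g a) * (v \<bullet> E y) \<ge> 0)"
        by (rule weak_side)
      also have "\<dots> \<longleftrightarrow> (\<forall>v\<in>?N. if v \<bullet> inv g a > 0 then v \<bullet> E y \<ge> 0 else v \<bullet> E y \<le> 0)"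
        using reg_inv[OF g] N_roots by (intro ball_cong refl) (force simp: zero_le_mult_iff)
      also have "\<dots> \<longleftrightarrow> y \<in> cell UNIV N (S g)"
      proof -
        have "y \<in> cell UNIV N (S g)
            \<longleftrightarrow> (\<forall>u\<in>N. if u \<bullet> D (inv g a) > 0 then u \<bullet> y \<ge> 0 else u \<bullet> y \<le> 0)"
          by (auto simp: cell_def S_def split: if_splits)
        then show ?thesis by (simp add: N_eq adj' DE)
      qed
      finally show ?thesis ..
    qed
    moreover have "D ` inv g ` C = {y. g (E y) \<in> C}"
    proof (intro set_eqI iffI)
      fix y assume "y \<in> {y. g (E y) \<in> C}"
      then show "y \<in> D ` inv g ` C"
        using DE(1)[of y] bij_mem[OF g] by (intro image_eqI[of _ _ "E y"] image_eqI[of _ _ "g (E y)"])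
          (auto simp: bij_is_inj)
    qed (use DE bij_mem[OF g] in \<open>auto simp: bij_is_surj surj_f_inv_f\<close>)
    ultimately show ?thesis by auto
  qed
  have open_ne: "D (inv g a) \<in> open_cell UNIV N (S g)" if g: "g \<in> W" for g
  proof -
    have "u \<bullet> D (inv g a) \<noteq> 0" if "u \<in> N" for u
      using that reg_inv[OF g] N_roots unfolding N_eq by (auto simp: adj)
    then show ?thesis by (auto simp: open_cell_def S_def not_less le_less)
  qed
  have inj_S: "inj_on S W"
  proof
    fix g h assume g: "g \<in> W" and h: "h \<in> W" and eq: "S g = S h"
    have "{v \<in> ?N. v \<bullet> inv g a > 0} = {v \<in> ?N. v \<bullet> inv h a > 0}"
      using eq unfolding S_alt by (simp add: inj_image_eq_iff[OF injE])
    then have "\<forall>v\<in>?N. (v \<bullet> inv h a) * (v \<bullet> inv g a) > 0"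
      using reg_inv[OF g] reg_inv[OF h] N_roots
      by (auto simp: zero_less_mult_iff set_eq_iff) (metis image_eqI linorder_neqE subsetD)+
    then have side: "\<forall>v\<in>roots W. (v \<bullet> inv h a) * (v \<bullet> inv g a) > 0" by (simp only: same_side)
    have hh: "h (inv h a) = a" using bij_mem[OF h] by (simp add: bij_is_surj surj_f_inv_f)
    \<comment> \<open>This element takes \<open>inv h a\<close> to \<open>inv g a\<close>, which
      lies in the same chamber.\<close>
    have "inv g \<circ> h = id"
      using side hh by (intro stabilizer_trivial[OF comp_mem[OF inv_mem[OF g] h], of "inv h a"]) simp
    then show "g = h"
      using bij_mem[OF g] by (metis comp_assoc comp_id id_comp bij_is_surj surj_iff)
  qed
  have surj_S: "T \<in> S ` W" if T: "T \<subseteq> N" and ne: "open_cell UNIV N T \<noteq> {}" for T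
  proof -
    obtain y where y: "y \<in> open_cell UNIV N T" using ne by auto
    have yT: "u \<in> T \<longleftrightarrow> u \<bullet> y > 0" "u \<bullet> y \<noteq> 0" if "u \<in> N" for u
      using y that by (force simp: open_cell_def)+
    have regE: "v \<bullet> E y \<noteq> 0" if v: "v \<in> roots W" for v
    proof -
      obtain u c where u: "u \<in> ?N" "c \<noteq> 0" "v = c *\<^sub>R u" using multiple[OF v] by blast
      then show ?thesis using yT(2)[of "E u"] by (auto simp: N_eq adj')
    qed
    then obtain g where g: "g \<in> W" "\<forall>v\<in>roots W. (v \<bullet> a) * (v \<bullet> g (E y)) > 0"
      using transitive_on_chambers[OF a regE] by blast
    then have "\<forall>v\<in>?N. (v \<bullet> inv g a) * (v \<bullet> E y) > 0"
      using move[OF g(1), of "\<lambda>r s. r * s > 0"] same_side by simp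
    then have "\<forall>v\<in>?N. v \<bullet> inv g a > 0 \<longleftrightarrow> v \<bullet> E y > 0"
      by (auto simp: zero_less_mult_iff)
    then have "\<forall>u\<in>N. u \<bullet> D (inv g a) > 0 \<longleftrightarrow> u \<bullet> y > 0"
      by (simp add: N_eq adj' DE)
    then have "T = S g"
      using T yT(1) by (auto simp: S_def)
    then show ?thesis using g(1) by blast
  qed
  have "int (card {g \<in> W. in_face_of_dim C k (g (E (closest_point (D ` inv g ` C) (D x))))})
      = \<bar>coeff (arrangement_charpoly ?A) k\<bar>" if gen: "generic UNIV N (D x)" for x k
  proof -
    have "in_face_of_dim C k (g (E (closest_point (D ` inv g ` C) (D x))))
        \<longleftrightarrow> projects_to_dim UNIV N (D x) k (S g)" if g: "g \<in> W" for g
    proof -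
      let ?P = "cell UNIV N (S g)"
      let ?z = "closest_point ?P (D x)"
      let ?f = "\<lambda>y. D (inv g y)"
      have z: "?z \<in> ?P"
        using open_ne[OF g] open_cell_subset_cell[of UNIV N "S g"]
        by (intro closest_point_in_set closed_cell) auto
      have lin: "linear ?f"
        using linear_compose[OF _ D, of "inv g"] orth[OF inv_mem[OF g]]
        by (simp add: orthogonal_transformation_def o_def)
      have inj: "inj ?f"
        using inj_compose[OF bij_is_inj[OF bijD] bij_is_inj[OF bij_mem[OF inv_mem[OF g]]]]
        by (simp add: o_def)
      have "in_face_of_dim C k (g (E ?z)) \<longleftrightarrow> in_face_of_dim (?f ` C) k (?f (g (E ?z)))"
        by (rule in_face_of_dim_linear_image[OF lin inj, symmetric])
      also have "?f ` C = ?P" using cell_eq[OF g] by (simp add: image_image)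
      also have "?f (g (E ?z)) = ?z" using bij_mem[OF g] DE by (simp add: bij_is_inj)
      also have "in_face_of_dim ?P k ?z \<longleftrightarrow> face_dim UNIV N ?z = k"
        using z finN by (intro in_face_of_dim_cell) (auto simp: S_def)
      finally show ?thesis
        using open_ne[OF g] unfolding projects_to_dim_def cell_eq[OF g] by auto
    qed
    then have "{g \<in> W. in_face_of_dim C k (g (E (closest_point (D ` inv g ` C) (D x))))}
        = {g \<in> W. projects_to_dim UNIV N (D x) k (S g)}" by auto
    moreover have "S ` {g \<in> W. projects_to_dim UNIV N (D x) k (S g)}
        = {T \<in> Pow N. projects_to_dim UNIV N (D x) k T}"
      using surj_S by (auto simp: projects_to_dim_def) (auto simp: S_def)
    then have "card {g \<in> W. projects_to_dim UNIV N (D x) k (S g)}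
        = card {T \<in> Pow N. projects_to_dim UNIV N (D x) k T}"
      using inj_S by (metis (no_types, lifting) card_image inj_on_subset mem_Collect_eq subsetI)
    moreover have "int (card {T \<in> Pow N. projects_to_dim UNIV N (D x) k T})
        = (-1) ^ (dim (UNIV :: 'a set) + k) * coeff (whitney_poly UNIV N) k"
      by (rule card_projects_to_dim[OF finN _ gen]) simp
    moreover have "whitney_poly UNIV N = arrangement_charpoly ?A"
      unfolding N_def
    proof (rule whitney_poly_normals[OF finA D bijD])
      fix H assume H: "H \<in> ?A"
      have "n H \<noteq> 0" using n(1)[OF H] by (simp add: roots_def)
      then show "E (n H) \<noteq> 0" using injE linear_0[OF E] by (metis injD)
      have "{x. E (n H) \<bullet> x = 0} = D ` {x. n H \<bullet> x = 0}"
      proof (intro set_eqI iffI)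
        fix x assume "x \<in> {x. E (n H) \<bullet> x = 0}"
        then show "x \<in> D ` {x. n H \<bullet> x = 0}"
          by (intro image_eqI[of _ _ "E x"]) (simp_all add: adj' DE)
      qed (auto simp: adj)
      then show "{x. E (n H) \<bullet> x = 0} = D ` H" using n(2)[OF H] by simp
    qed
    ultimately have "int (card {g \<in> W. in_face_of_dim C k (g (E (closest_point (D ` inv g ` C) (D x))))})
        = (-1) ^ (dim (UNIV :: 'a set) + k) * coeff (arrangement_charpoly ?A) k" by simp
    \<comment> \<open>The count is nonnegative, so passing to absolute values removes the power of
      \<open>-1\<close>.\<close>
    moreover from this have "\<bar>int (card {g \<in> W. in_face_of_dim C k
          (g (E (closest_point (D ` inv g ` C) (D x))))})\<bar> = \<bar>coeff (arrangement_charpoly ?A) k\<bar>"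
      by (simp add: abs_mult power_abs)
    ultimately show ?thesis by simp
  qed
  then show ?thesis using finN by blast
qed

end

subsection \<open>Types A and B\<close>

text \<open>Being bijective and order preserving in both directions, \<open>p\<close> preserves the
  rank of an index, the number of indices with smaller value. Ranks separate the values of
  \<open>f\<close>.\<close>

lemma strict_mono_bij_eq_id:
  fixes f :: "'n::finite \<Rightarrow> 'b::linorder"
  assumes p: "bij p" and f: "inj f" and mono: "\<And>i j. f i < f j \<Longrightarrow> f (p i) < f (p j)"
  shows "p = id"
proof
  fix i
  let ?r = "\<lambda>i. card {j. f j < f i}"
  have iff: "f (p j) < f (p i) \<longleftrightarrow> f j < f i" for i j
    using mono f by (metis injD linorder_less_linear order_less_asym)
  have "{j. f j < f (p i)} = p ` {j. f j < f i}"
  proof (intro set_eqI iffI)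
    fix j assume "j \<in> {j. f j < f (p i)}"
    moreover have "j = p (inv p j)" using p by (simp add: bij_is_surj surj_f_inv_f)
    ultimately show "j \<in> p ` {j. f j < f i}" using iff by (metis imageI mem_Collect_eq)
  qed (use iff in auto)
  then have rank: "?r (p i) = ?r i"
    using card_image[OF inj_on_subset[OF bij_is_inj[OF p] subset_UNIV]] by simp
  have less: "?r i < ?r j" if "f i < f j" for i j
    using that by (intro psubset_card_mono) auto
  have "f (p i) = f i" using less rank by (metis linorder_neqE less_irrefl)
  then show "p i = id i" using f by (simp add: inj_eq)
qed

section \<open>Signed permutations and their roots\<close>

definition signed_perm :: "('n \<Rightarrow> real) \<Rightarrow> ('n \<Rightarrow> 'n) \<Rightarrow> real ^ 'n \<Rightarrow> real ^ 'n" where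
  "signed_perm s p x = (\<chi> i. s i * x $ p i)"

lemma signed_perm_nth [simp]: "signed_perm s p x $ i = s i * x $ p i"
  by (simp add: signed_perm_def)

lemma typeA_signed_perm: "typeA = {signed_perm (\<lambda>_. 1) p | p. bij p}"
  by (simp add: typeA_def signed_perm_def [abs_def])

lemma typeB_signed_perm: "typeB = {signed_perm s p | s p. bij p \<and> (\<forall>i. s i \<in> {1, -1})}"
  by (simp add: typeB_def signed_perm_def [abs_def])

lemma signed_perm_comp: "signed_perm s p \<circ> signed_perm t q = signed_perm (\<lambda>i. s i * t (p i)) (q \<circ> p)"
  by (auto simp: fun_eq_iff vec_eq_iff)

lemma signed_perm_id: "signed_perm (\<lambda>_. 1) id = id"
  by (auto simp: fun_eq_iff vec_eq_iff)

lemma signed_perm_inv: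
  assumes "bij p" "\<forall>i. s i \<in> {1, -1}"
  shows "inv (signed_perm s p) = signed_perm (\<lambda>i. s (inv p i)) (inv p)"
proof (rule inv_unique_comp)
  have s: "s i * s i = 1" for i using assms(2)[rule_format, of i] by auto
  have "inv p \<circ> p = id" "p \<circ> inv p = id" "\<And>i. inv p (p i) = i"
    using assms(1) by (auto simp: bij_is_inj bij_is_surj fun_eq_iff surj_f_inv_f)
  then show "signed_perm s p \<circ> signed_perm (\<lambda>i. s (inv p i)) (inv p) = id"
    "signed_perm (\<lambda>i. s (inv p i)) (inv p) \<circ> signed_perm s p = id"
    by (simp_all add: signed_perm_comp s signed_perm_id)
qed

lemma orthogonal_signed_perm:
  assumes "bij p" "\<forall>i. s i \<in> {1, -1}"
  shows "orthogonal_transformation (signed_perm s p)"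
  unfolding orthogonal_transformation_def
proof (intro conjI allI)
  show "linear (signed_perm s p)"
    by (intro linearI) (auto simp: vec_eq_iff algebra_simps)
  fix x y
  have s: "s i * s i = 1" for i using assms(2)[rule_format, of i] by auto
  have "signed_perm s p x \<bullet> signed_perm s p y = (\<Sum>i\<in>UNIV. (s i * s i) * (x $ p i * y $ p i))"
    by (simp add: inner_vec_def algebra_simps)
  also have "\<dots> = (\<Sum>i\<in>UNIV. x $ i * y $ i)"
    using sum.reindex_bij_betw[OF assms(1), of "\<lambda>i. x $ i * y $ i"] by (simp add: s)
  finally show "signed_perm s p x \<bullet> signed_perm s p y = x \<bullet> y" by (simp add: inner_vec_def)
qed

text \<open>The scalar \<open>c\<close> selects the mirror \<open>x_i = x_j\<close> or
  \<open>x_i = -x_j\<close>. For \<open>c = 1\<close> the hypothesis on \<open>W\<close> concerns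
  unsigned permutations only, so the lemma serves both types.\<close>

lemma swap_root:
  fixes i j :: "'n::finite"
  assumes "i \<noteq> j" "c \<in> {1, -1}" "\<And>s p. bij p \<Longrightarrow> (\<And>i. s i \<in> {c, 1}) \<Longrightarrow> signed_perm s p \<in> W"
  shows "axis i 1 - c *\<^sub>R axis j 1 \<in> roots W"
proof -
  let ?v = "axis i 1 - c *\<^sub>R axis j (1::real)"
  define s where "s k = (if k = i \<or> k = j then c else 1)" for k
  define p where "p = id(i := j, j := i)"
  have "p \<circ> p = id" using assms(1) by (auto simp: p_def fun_eq_iff)
  then have p: "bij p" by (rule o_bij) fact
  have vv: "?v \<bullet> ?v = 2"
    using assms(1,2) by (auto simp: inner_diff_left inner_diff_right inner_add_left inner_add_right inner_axis_axis)
  have vx: "?v \<bullet> x = x $ i - c * x $ j" for x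
    by (simp add: inner_diff_left inner_axis')
  have "reflection ?v x $ k = signed_perm s p x $ k" for x k
    using assms(1,2) unfolding reflection_def vv vx
    by (auto simp: s_def p_def axis_def diff_divide_distrib add_divide_distrib)
  then have "reflection ?v = signed_perm s p" by (simp add: fun_eq_iff vec_eq_iff)
  moreover have "?v \<noteq> 0" using vv by auto
  ultimately show ?thesis using assms(3)[OF p, of s] by (simp add: roots_def s_def)
qed

lemma sign_root:
  fixes i :: "'n::finite"
  assumes "\<And>s p. bij p \<Longrightarrow> (\<And>i. s i \<in> {-1, 1}) \<Longrightarrow> signed_perm s p \<in> W"
  shows "axis i 1 \<in> roots W"
proof -
  have e: "axis i (1::real) \<bullet> x = x $ i" "axis i (1::real) \<bullet> axis i 1 = 1" for x
    by (simp_all add: inner_axis' inner_axis_axis)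
  have "reflection (axis i 1) x $ k = signed_perm (\<lambda>k. if k = i then -1 else 1) id x $ k" for x k
    unfolding reflection_def e by (auto simp: axis_def)
  then have "reflection (axis i 1) = signed_perm (\<lambda>k. if k = i then -1 else 1) id"
    by (simp add: fun_eq_iff vec_eq_iff)
  then show ?thesis using assms[of id "\<lambda>k. if k = i then -1 else 1"] by (simp add: roots_def axis_eq_0_iff)
qed

text \<open>The roots \<open>axis i 1 - axis j 1\<close> make the coordinates of \<open>b\<close>
  distinct and force \<open>p\<close> to preserve their order.\<close>

lemma stabilizer_typeA:
  assumes "bij p" and side: "\<And>v. v \<in> roots typeA \<Longrightarrow> (v \<bullet> b) * (v \<bullet> signed_perm (\<lambda>_. 1) p b) > 0"
  shows "signed_perm (\<lambda>_. 1) p = id"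
proof -
  have *: "(b $ i - b $ j) * (b $ p i - b $ p j) > 0" if "i \<noteq> j" for i j
  proof -
    have "signed_perm s q \<in> typeA" if "bij q" "\<And>i. s i \<in> {1, 1}" for s and q :: "'a \<Rightarrow> 'a"
    proof -
      have "s = (\<lambda>_. 1)" using that(2) by auto
      then show ?thesis using that(1) by (auto simp: typeA_signed_perm)
    qed
    then have "axis i 1 - 1 *\<^sub>R axis j 1 \<in> roots (typeA :: (real ^ 'a \<Rightarrow> real ^ 'a) set)"
      using that by (intro swap_root) auto
    from side[OF this] show ?thesis by (simp add: inner_diff_left inner_axis')
  qed
  have "p = id"
  proof (rule strict_mono_bij_eq_id[OF assms(1)])
    show "inj (\<lambda>i. b $ i)"
      using * by (intro injI) (metis diff_self mult_zero_left less_irrefl)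
    fix i j assume "b $ i < b $ j"
    then show "b $ p i < b $ p j" using *[of i j] by (auto simp: zero_less_mult_iff)
  qed
  then show ?thesis by (simp add: signed_perm_id)
qed

text \<open>Multiplying the conditions for the difference and the sum of two unit vectors shows that
  \<open>p\<close> preserves the order of the squared coordinates of \<open>b\<close>, so
  \<open>p\<close> is the identity. The unit vectors themselves then force every sign to be
  1.\<close>

lemma stabilizer_typeB:
  assumes p: "bij p" and s: "\<forall>i. s i \<in> {1, -1}"
    and side: "\<And>v. v \<in> roots typeB \<Longrightarrow> (v \<bullet> b) * (v \<bullet> signed_perm s p b) > 0"
  shows "signed_perm s p = id"
proof -
  have mem: "signed_perm t q \<in> typeB" if "bij q" "\<And>i. t i \<in> {-1, 1}" for t and q :: "'a \<Rightarrow> 'a"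
    using that by (auto simp: typeB_signed_perm)
  have sign: "b $ i * (s i * b $ p i) > 0" for i
    using side[OF sign_root[OF mem], of i] by (simp add: inner_axis')
  have *: "((b $ i)\<^sup>2 - (b $ j)\<^sup>2) * ((b $ p i)\<^sup>2 - (b $ p j)\<^sup>2) > 0" if "i \<noteq> j" for i j
  proof -
    let ?c = "signed_perm s p b"
    have sq: "(?c $ k)\<^sup>2 = (b $ p k)\<^sup>2" for k
      using s[rule_format, of k] by (auto simp: power_mult_distrib)
    have "axis i 1 - 1 *\<^sub>R axis j 1 \<in> roots (typeB :: (real ^ 'a \<Rightarrow> real ^ 'a) set)"
      "axis i 1 - (-1) *\<^sub>R axis j 1 \<in> roots (typeB :: (real ^ 'a \<Rightarrow> real ^ 'a) set)"
      using that by (auto intro!: swap_root[of i j 1, simplified] swap_root[of i j "-1", simplified] mem)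
    from this[THEN side]
    have "(b $ i - b $ j) * (?c $ i - ?c $ j) > 0" "(b $ i + b $ j) * (?c $ i + ?c $ j) > 0"
      by (simp_all add: inner_diff_left inner_add_left inner_axis')
    then have "((b $ i - b $ j) * (?c $ i - ?c $ j)) * ((b $ i + b $ j) * (?c $ i + ?c $ j)) > 0"
      by (rule mult_pos_pos)
    also have "((b $ i - b $ j) * (?c $ i - ?c $ j)) * ((b $ i + b $ j) * (?c $ i + ?c $ j))
        = ((b $ i)\<^sup>2 - (b $ j)\<^sup>2) * ((?c $ i)\<^sup>2 - (?c $ j)\<^sup>2)"
      by (simp only: power2_eq_square) (simp only: algebra_simps)
    finally show ?thesis unfolding sq .
  qed
  have "p = id"
  proof (rule strict_mono_bij_eq_id[OF p])
    show "inj (\<lambda>i. (b $ i)\<^sup>2)"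
      using * by (intro injI) (metis diff_self mult_zero_left less_irrefl)
    fix i j assume "(b $ i)\<^sup>2 < (b $ j)\<^sup>2"
    then show "(b $ p i)\<^sup>2 < (b $ p j)\<^sup>2" using *[of i j] by (auto simp: zero_less_mult_iff)
  qed
  moreover have "s i = 1" for i
    using sign[of i] s[rule_format, of i] calculation by (auto simp: mult_less_0_iff)
  then have "s = (\<lambda>_. 1)" by auto
  ultimately show ?thesis by (simp add: signed_perm_id)
qed

lemma mirror_group_typeA: "mirror_group (typeA :: (real ^ 'n \<Rightarrow> real ^ 'n) set)"
proof
  show "finite (typeA :: (real ^ 'n \<Rightarrow> real ^ 'n) set)" by (rule finite_typeA)
  show "(id :: real ^ 'n \<Rightarrow> _) \<in> typeA"
    unfolding typeA_signed_perm using signed_perm_id bij_id by (metis (mono_tags, lifting) mem_Collect_eq)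
  fix g h :: "real ^ 'n \<Rightarrow> real ^ 'n" and b
  assume "g \<in> typeA"
  then obtain p where p: "bij p" "g = signed_perm (\<lambda>_. 1) p" by (auto simp: typeA_signed_perm)
  show "orthogonal_transformation g" using p by (simp add: orthogonal_signed_perm)
  show "inv g \<in> typeA" using p by (auto simp: signed_perm_inv typeA_signed_perm bij_imp_bij_inv)
  show "g \<circ> h \<in> typeA" if "h \<in> typeA"
    using that p by (auto simp: typeA_signed_perm signed_perm_comp bij_comp)
  show "g = id" if "\<And>v. v \<in> roots typeA \<Longrightarrow> (v \<bullet> b) * (v \<bullet> g b) > 0"
    using that p stabilizer_typeA by metis
qed

lemma mirror_group_typeB: "mirror_group (typeB :: (real ^ 'n \<Rightarrow> real ^ 'n) set)"
proof
  show "finite (typeB :: (real ^ 'n \<Rightarrow> real ^ 'n) set)" by (rule finite_typeB)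
  show "(id :: real ^ 'n \<Rightarrow> _) \<in> typeB"
    using typeA_subset_typeB mirror_group.id_mem[OF mirror_group_typeA] by blast
  fix g h :: "real ^ 'n \<Rightarrow> real ^ 'n" and b
  assume "g \<in> typeB"
  then obtain s p where p: "bij p" "\<forall>i. s i \<in> {1, -1}" "g = signed_perm s p"
    by (auto simp: typeB_signed_perm)
  show "orthogonal_transformation g" using p by (simp add: orthogonal_signed_perm)
  show "inv g \<in> typeB"
    unfolding p(3) signed_perm_inv[OF p(1,2)] typeB_signed_perm
    using p(2) bij_imp_bij_inv[OF p(1)] by blast
  show "g \<circ> h \<in> typeB" if h: "h \<in> typeB"
  proof -
    obtain t q where q: "bij q" "\<forall>i. t i \<in> {1, -1}" "h = signed_perm t q"
      using h by (auto simp: typeB_signed_perm)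
    have "s i * t (p i) \<in> {1, -1}" for i
      using p(2)[rule_format, of i] q(2)[rule_format, of "p i"] by auto
    then show ?thesis
      unfolding p q signed_perm_comp typeB_signed_perm using bij_comp[OF p(1) q(1)] by blast
  qed
  show "g = id" if "\<And>v. v \<in> roots typeB \<Longrightarrow> (v \<bullet> b) * (v \<bullet> g b) > 0"
    using that p stabilizer_typeB by metis
qed

section \<open>Weighted projections as Euclidean ones\<close>

lemma act_weights_signed_perm:
  assumes "\<forall>i. s i \<in> {1, -1}"
  shows "act_weights (signed_perm s p) w $ i = w $ p i"
proof -
  have "(THE j. (\<forall>x. signed_perm s p x $ i = x $ j) \<or> (\<forall>x. signed_perm s p x $ i = - (x $ j))) = p i"
  proof (rule the_equality)
    show "(\<forall>x. signed_perm s p x $ i = x $ p i) \<or> (\<forall>x. signed_perm s p x $ i = - (x $ p i))"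
      using assms[rule_format, of i] by auto
    fix j assume "(\<forall>x. signed_perm s p x $ i = x $ j) \<or> (\<forall>x. signed_perm s p x $ i = - (x $ j))"
    then have "\<bar>signed_perm s p (axis j 1) $ i\<bar> = \<bar>axis j 1 $ j\<bar>"
      by (metis abs_minus_cancel)
    then show "j = p i" by (auto simp: axis_def split: if_splits)
  qed
  then show ?thesis by (simp add: act_weights_def)
qed

text \<open>\<open>arg_min_on\<close> is a choice among minimizers, so a strict minimizer determines
  it.\<close>

lemma arg_min_on_eqI:
  fixes f :: "'a \<Rightarrow> 'b::linorder"
  assumes "c \<in> S" "\<And>y. y \<in> S \<Longrightarrow> y \<noteq> c \<Longrightarrow> f c < f y"
  shows "arg_min_on f S = c"
  unfolding arg_min_on_def arg_min_def is_arg_min_def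
proof (rule some_equality)
  show "c \<in> S \<and> (\<nexists>y. y \<in> S \<and> f y < f c)"
    using assms by (metis less_asym less_irrefl)
qed (use assms in blast)

text \<open>Writing a competitor as \<open>g u\<close> cancels the signs, and reindexing by
  \<open>p\<close> restores the weights \<open>w\<close>, so the objective becomes the squared
  distance between \<open>D x\<close> and \<open>D u\<close>. The image of \<open>C\<close> is
  closed and convex, which makes its minimizer unique.\<close>

lemma weighted_projection_signed_perm:
  fixes C :: "(real ^ 'n) set" and w x :: "real ^ 'n"
  assumes w: "\<forall>i. w $ i > 0" and p: "bij p" and s: "\<forall>i. s i \<in> {1, -1}"
    and C: "closed C" "convex C" "C \<noteq> {}"
  defines "g \<equiv> signed_perm s p"
    and "D \<equiv> (\<lambda>x. \<chi> i. sqrt (w $ i) * x $ i) :: real ^ 'n \<Rightarrow> real ^ 'n"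
    and "E \<equiv> (\<lambda>x. \<chi> i. x $ i / sqrt (w $ i)) :: real ^ 'n \<Rightarrow> real ^ 'n"
  shows "weighted_projection C (act_weights g w) (g x) = g (E (closest_point (D ` inv g ` C) (D x)))"
proof -
  let ?f = "\<lambda>z. \<Sum>i\<in>UNIV. act_weights g w $ i * (z $ i - g x $ i)\<^sup>2"
  let ?P = "D ` inv g ` C"
  let ?z = "closest_point ?P (D x)"
  have sw: "sqrt (w $ i) \<noteq> 0" for i using w by (metis less_irrefl real_sqrt_eq_zero_cancel_iff)
  have DE: "D (E y) = y" "E (D y) = y" for y
    using sw by (simp_all add: D_def E_def vec_eq_iff)
  have orth: "orthogonal_transformation g" unfolding g_def by (rule orthogonal_signed_perm[OF p s])
  then have bij: "bij g" by (rule orthogonal_transformation_bij)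
  have f: "?f (g u) = (dist (D x) (D u))\<^sup>2" for u
  proof -
    have "?f (g u) = (\<Sum>i\<in>UNIV. w $ p i * (u $ p i - x $ p i)\<^sup>2)"
    proof (intro sum.cong refl)
      fix i
      have "(s i * u $ p i - s i * x $ p i)\<^sup>2 = (u $ p i - x $ p i)\<^sup>2"
        using s[rule_format, of i] by (auto simp: power2_commute)
      then show "act_weights g w $ i * (g u $ i - g x $ i)\<^sup>2 = w $ p i * (u $ p i - x $ p i)\<^sup>2"
        by (simp add: g_def act_weights_signed_perm[OF s])
    qed
    also have "\<dots> = (\<Sum>i\<in>UNIV. w $ i * (u $ i - x $ i)\<^sup>2)"
      by (rule sum.reindex_bij_betw[OF p])
    also have "\<dots> = (\<Sum>i\<in>UNIV. (sqrt (w $ i) * x $ i - sqrt (w $ i) * u $ i)\<^sup>2)"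
    proof (intro sum.cong refl)
      fix i
      have "(sqrt (w $ i) * x $ i - sqrt (w $ i) * u $ i)\<^sup>2 = (sqrt (w $ i))\<^sup>2 * (x $ i - u $ i)\<^sup>2"
        by (simp add: power_mult_distrib flip: right_diff_distrib)
      then show "w $ i * (u $ i - x $ i)\<^sup>2 = (sqrt (w $ i) * x $ i - sqrt (w $ i) * u $ i)\<^sup>2"
        using w[rule_format, of i] by (simp add: power2_commute)
    qed
    also have "\<dots> = (dist (D x) (D u))\<^sup>2"
      unfolding dist_norm power2_norm_eq_inner inner_vec_def by (simp add: D_def power2_eq_square)
    finally show ?thesis .
  qed
  have lin: "linear (\<lambda>y. D (inv g y))"
  proof -
    have "linear D" by (intro linearI) (auto simp: D_def vec_eq_iff algebra_simps)
    moreover have "linear (inv g)"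
      using orthogonal_transformation_inv[OF orth] by (simp add: orthogonal_transformation_def)
    ultimately show ?thesis using linear_compose[of "inv g" D] by (simp add: o_def)
  qed
  have injD: "inj (\<lambda>y. D (inv g y))"
  proof (rule injI)
    fix y z assume "D (inv g y) = D (inv g z)"
    then have "inv g y = inv g z" using DE(2) by metis
    then show "y = z" using bij by (metis bij_inv_eq_iff)
  qed
  have P: "?P = (\<lambda>y. D (inv g y)) ` C" by (simp add: image_image)
  have clP: "closed ?P" unfolding P by (rule closed_injective_linear_image[OF C(1) lin injD])
  have cvP: "convex ?P" unfolding P by (rule convex_linear_image[OF lin C(2)])
  have zP: "?z \<in> ?P" using clP C(3) by (intro closest_point_in_set) auto
  show ?thesis
    unfolding weighted_projection_def
  proof (rule arg_min_on_eqI)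
    obtain c where c: "c \<in> C" "?z = D (inv g c)" using zP by blast
    then have "g (E ?z) = c" using bij by (simp add: DE bij_is_surj surj_f_inv_f)
    then show "g (E ?z) \<in> C" using c(1) by simp
    fix y assume y: "y \<in> C" "y \<noteq> g (E ?z)"
    let ?u = "inv g y"
    have gu: "g ?u = y" using bij by (simp add: bij_is_surj surj_f_inv_f)
    have Du: "D ?u \<in> ?P" using y(1) by blast
    have "D ?u \<noteq> ?z" using y(2) DE(2) gu by metis
    then have "dist (D x) ?z < dist (D x) (D ?u)"
      using closest_point_lt[OF cvP clP Du] by simp
    then have "(dist (D x) (D (E ?z)))\<^sup>2 < (dist (D x) (D ?u))\<^sup>2"
      unfolding DE by (intro power_strict_mono) auto
    then show "?f (g (E ?z)) < ?f y" using f[of "E ?z"] f[of ?u] gu by simp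
  qed
qed

theorem theorem18:
  fixes W :: "(real ^ 'n \<Rightarrow> real ^ 'n) set" and C :: "(real ^ 'n) set" and w :: "real ^ 'n"
  assumes "W = typeA \<or> W = typeB"
    and "fundamental_chamber W C"
    and "\<forall>i. w $ i > 0"
  shows "AE x in lebesgue. x \<in> C \<longrightarrow>
           (\<forall>k. int (card {g \<in> W. in_face_of_dim C k
                                (weighted_projection C (act_weights g w) (g x))})
              = \<bar>coeff (arrangement_charpoly (reflection_arrangement W)) k\<bar>)"
proof -
  interpret mirror_group W
    using assms(1) mirror_group_typeA mirror_group_typeB by blast
  obtain a where a: "\<And>v. v \<in> roots W \<Longrightarrow> v \<bullet> a \<noteq> 0"
    and C: "C = {y. \<forall>v\<in>roots W. (v \<bullet> a) * (v \<bullet> y) \<ge> 0}"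
    using fundamental_chamber_halfspaces[OF assms(2)] by blast
  define D where "D = (\<lambda>x. \<chi> i. sqrt (w $ i) * x $ i :: real ^ 'n)"
  define E where "E = (\<lambda>x. \<chi> i. x $ i / sqrt (w $ i) :: real ^ 'n)"
  have sw: "sqrt (w $ i) \<noteq> 0" for i
    using assms(3) by (metis less_irrefl real_sqrt_eq_zero_cancel_iff)
  have lin: "linear D" "linear E"
    by (auto intro!: linearI simp: D_def E_def vec_eq_iff algebra_simps add_divide_distrib)
  have DE: "D (E x) = x" "E (D x) = x" "E x \<bullet> D y = x \<bullet> y" for x y
    using sw by (simp_all add: D_def E_def vec_eq_iff inner_vec_def)
  \<comment> \<open>\<open>N\<close> depends on neither \<open>x\<close> nor \<open>k\<close>, so
    one null set serves all \<open>k\<close>.\<close>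
  obtain N where N: "finite N" "\<And>x k. generic UNIV N (D x) \<Longrightarrow>
    int (card {g \<in> W. in_face_of_dim C k (g (E (closest_point (D ` inv g ` C) (D x))))})
      = \<bar>coeff (arrangement_charpoly (reflection_arrangement W)) k\<bar>"
    using card_chamber_projections[OF a C lin DE] by blast
  have hs: "C = (\<Inter>v\<in>roots W. {y. ((v \<bullet> a) *\<^sub>R v) \<bullet> y \<ge> 0})" unfolding C by auto
  have cC: "closed C" "convex C" "C \<noteq> {}"
  proof -
    show "closed C" unfolding hs by (intro closed_INT ballI closed_halfspace_ge)
    show "convex C" unfolding hs by (intro convex_INT convex_halfspace_ge)
    have "a \<in> C" unfolding C by simp
    then show "C \<noteq> {}" by auto
  qed
  have proj: "weighted_projection C (act_weights g w) (g x) = g (E (closest_point (D ` inv g ` C) (D x)))"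
    if g: "g \<in> W" for g x
  proof -
    have "g \<in> typeB" using g assms(1) typeA_subset_typeB by blast
    then obtain s p where "bij p" "\<forall>i. s i \<in> {1, -1}" "g = signed_perm s p"
      by (auto simp: typeB_signed_perm)
    then show ?thesis
      using weighted_projection_signed_perm[OF assms(3) _ _ cC] unfolding D_def E_def by blast
  qed
  \<comment> \<open>The exceptional \<open>x\<close> lie in the image under the linear map
    \<open>E\<close> of a null set, which is again null.\<close>
  have "negligible (E ` {y. \<not> generic UNIV N y})"
    using negligible_not_generic[OF N(1)] lin(2)
    by (intro negligible_differentiable_image_negligible linear_imp_differentiable_on) auto
  moreover have "{x. \<not> generic UNIV N (D x)} \<subseteq> E ` {y. \<not> generic UNIV N y}"
    using DE(2) by (metis (mono_tags, lifting) image_eqI mem_Collect_eq subsetI)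
  ultimately have "negligible {x. \<not> generic UNIV N (D x)}" by (rule negligible_subset)
  then have "AE x in lebesgue. generic UNIV N (D x)"
    by (intro AE_I'[of "{x. \<not> generic UNIV N (D x)}"]) (auto simp: negligible_iff_null_sets)
  then show ?thesis
  proof eventually_elim
    case (elim x)
    have "{g \<in> W. in_face_of_dim C k (weighted_projection C (act_weights g w) (g x))}
        = {g \<in> W. in_face_of_dim C k (g (E (closest_point (D ` inv g ` C) (D x))))}" for k
      by (auto simp: proj)
    then show ?case using N(2)[OF elim] by simp
  qed
qed

end
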